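(* (i) If $v=2k\geq4$, then $\mathrm{A}_q(v,v-1)=\mathrm{A}_q(v,v;k)=q^k+1$. Every $(v,q^k+1,v-1)_q$ subspace code contains, besides $k$-dimensional subspaces, at most one subspace of dimension $k-1$, at most one of dimension $k+1$, and none of any other dimension; the dimension distributions realized by such codes are exactly $(\delta_{k-1},\delta_k,\delta_{k+1})\in\{(0,q^k+1,0),(1,q^k,0),(0,q^k,1),(1,q^k-1,1)\}$ (with $\delta_t=0$ otherwise). (ii) If $v=2k+1\geq5$, then $\mathrm{A}_q(v,v-1)=\mathrm{A}_q(v,v-1;k)=q^{k+1}+1$, and the dimension distributions realized by $(v,q^{k+1}+1,v-1)_q$ subspace codes are exactly those with $(\delta_{k-1},\delta_k,\delta_{k+1},\delta_{k+2})$ equal to one of $(0,q^{k+1}+1,0,0)$, $(0,0,q^{k+1}+1,0)$, $(0,q^{k+1},1,0)$, $(0,1,q^{k+1},0)$, $(0,q^{k+1},0,1)$, $(1,0,q^{k+1},0)$ and $\delta_t=0$ for all other $t$.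
   Context: $\mathrm{d}_{\mathrm{S}}(X,Y)=\dim(X+Y)-\dim(X\cap Y)$. A $(v,M,d)_q$ subspace code is a set of $M$ subspaces of a $v$-dimensional $\mathbb{F}_q$-space with minimum pairwise subspace distance $d$. $\mathrm{A}_q(v,d)$ is the maximum size of a set of subspaces of $\mathbb{F}_q^v$ with pairwise distance $\ge d$; $\mathrm{A}_q(v,d;k)$ the same restricted to $k$-dimensional subspaces. The dimension distribution of a code $\mathcal{C}$ is $(\delta_0,\dots,\delta_v)$ with $\delta_t$ the number of codewords of dimension $t$. *)

theory Defs
  imports "HOL-Analysis.Analysis"
begin

text \<open>Ambient space: F_q^v rendered as 'a^'n with 'a a finite field (q = CARD('a)),
  v = CARD('n).  Subspaces, span and dimension are the library notions vec.subspace,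
  vec.span, vec.dim of the vector space (*s) over 'a.\<close>

definition subspaces :: "('a::field ^ 'n) set set" where
  "subspaces = {U. vec.subspace U}"

definition sdist :: "('a::field ^ 'n) set \<Rightarrow> ('a ^ 'n) set \<Rightarrow> nat" where
  "sdist X Y = vec.dim (vec.span (X \<union> Y)) - vec.dim (X \<inter> Y)"

definition is_code :: "('a::field ^ 'n) set set \<Rightarrow> nat \<Rightarrow> bool" where
  "is_code C d \<longleftrightarrow> C \<subseteq> subspaces \<and> (\<forall>X\<in>C. \<forall>Y\<in>C. X \<noteq> Y \<longrightarrow> d \<le> sdist X Y)"

text \<open>A_q(v,d) and A_q(v,d;k); the type argument fixes the field and the ambient dimension.\<close>
definition Aq :: "('a::field ^ 'n) itself \<Rightarrow> nat \<Rightarrow> nat" where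
  "Aq _ d = Max (card ` {C :: ('a ^ 'n) set set. is_code C d})"

definition Aq_const :: "('a::field ^ 'n) itself \<Rightarrow> nat \<Rightarrow> nat \<Rightarrow> nat" where
  "Aq_const _ d k = Max (card ` {C :: ('a ^ 'n) set set. is_code C d \<and> (\<forall>U\<in>C. vec.dim U = k)})"

definition dim_distr :: "('a::field ^ 'n) set set \<Rightarrow> nat \<Rightarrow> nat" where
  "dim_distr C t = card {U \<in> C. vec.dim U = t}"

definition distr_from :: "nat \<Rightarrow> nat list \<Rightarrow> nat \<Rightarrow> nat" where
  "distr_from s ds t = (if s \<le> t \<and> t - s < length ds then ds ! (t - s) else 0)"

end

theory Submission
  imports Defs "HOL-Algebra.Algebraic_Closure_Type"
begin

text \<open>
  Distance at least v - 1 forces the dimensions of two words to add up to v - 1, v or v + 1, and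
  their intersection to be as small as possible.  Hence all words of a large code have dimension
  close to v / 2, and the bounds come from counting nonzero vectors, either in the whole space or
  outside a word of large dimension.  For v = 2k + 1 there are two harder cases.  A partial spread
  of k-spaces is bounded by counting words in hyperplanes.  If k-spaces and (k+1)-spaces are mixed,
  Cauchy-Schwarz for the number of (k+1)-words through a point gives a quadratic inequality whose
  only admissible solutions of full size have at most one word of one of the two kinds.
  Orthogonal complements exchange the remaining cases.

  Extremal codes arise from graphs of multiplications by elements of an extension field; the
  distinguished word \<open>0 \<oplus> K\<close> may be replaced by a subspace or a superspace.
\<close>

(* HOL-Algebra reserves X, and formal power series overload the component operator. *)
unbundle no Formal_Power_Series.fps_syntax
no_notation var (\<open>X\<index>\<close>)

subsection \<open>Counting in vector spaces over finite fields\<close>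

text \<open>Counting vectors is sharp in even dimension but not in odd dimension. For v = 2k + 1 it
  allows q^(k+1) + q k-spaces with pairwise trivial intersection, which is q - 1 too many, and
  (k+1)-words overlap pairwise, so that their union cannot be measured by adding sizes. Hyperplanes
  close the first gap because each of them can hold only few words; second moments close the other.
  The quadratic inequality says too little when there are too many (k+1)-words, so it is applied to
  subfamilies of a chosen size. Complementation carries (k+1)-words to k-words, so the partial
  spread bound limits both kinds.

  The constructions need the field of order q^m for a variable m, which no type can provide. It is
  therefore a set: the fixed points of x -> x^(q^m) in the algebraic closure of F_q. Multiplications
  by c and d with c different from d agree only at 0, because c - d is invertible; this is why their
  graphs meet trivially.\<close>

lemma (in vector_space) card_span_independent:
  assumes "finite B" "independent B"
  shows "card (span B) = CARD('a) ^ card B"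
proof -
  let ?f = "\<lambda>c. \<Sum>b\<in>B. scale (c b) b"
  have "bij_betw ?f (B \<rightarrow>\<^sub>E UNIV) (span B)"
    unfolding bij_betw_def
  proof
    show "inj_on ?f (B \<rightarrow>\<^sub>E UNIV)"
    proof (rule inj_onI)
      fix c d assume cd: "c \<in> B \<rightarrow>\<^sub>E UNIV" "d \<in> B \<rightarrow>\<^sub>E UNIV" and eq: "?f c = ?f d"
      have "(\<Sum>b\<in>B. scale (c b - d b) b) = 0"
        using eq by (simp add: scale_left_diff_distrib sum_subtractf)
      then have "\<forall>b\<in>B. c b - d b = 0"
        using assms independentD[of B B "\<lambda>b. c b - d b"] by auto
      then show "c = d" using cd by (intro PiE_ext) auto
    qed
    show "?f ` (B \<rightarrow>\<^sub>E UNIV) = span B"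
    proof
      show "?f ` (B \<rightarrow>\<^sub>E UNIV) \<subseteq> span B"
      proof (rule image_subsetI)
        fix c
        show "?f c \<in> span B" by (rule span_sum) (rule span_scale, rule span_base)
      qed
      show "span B \<subseteq> ?f ` (B \<rightarrow>\<^sub>E UNIV)"
      proof
        fix x assume "x \<in> span B"
        then obtain u where u: "x = ?f u"
          using span_finite[OF \<open>finite B\<close>] by auto
        have "x = ?f (restrict u B)" unfolding u by (rule sum.cong) auto
        then show "x \<in> ?f ` (B \<rightarrow>\<^sub>E UNIV)" by (rule image_eqI[where x = "restrict u B"]) simp
      qed
    qed
  qed
  from bij_betw_same_card[OF this] show ?thesis
    by (simp add: card_PiE assms)
qed

lemma card_subspace:
  fixes U :: "('a::field ^ 'n::finite) set"
  assumes "vec.subspace U"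
  shows "card U = CARD('a) ^ vec.dim U"
proof -
  obtain B where "B \<subseteq> U" "vec.independent B" "U \<subseteq> vec.span B" "card B = vec.dim U"
    using vec.basis_exists by blast
  moreover from this have "vec.span B = U"
    using assms vec.span_minimal by blast
  ultimately show ?thesis
    using vec.card_span_independent[of B] vec.finiteI_independent[of B] by simp
qed

lemma CARD_field_gt_1: "1 < CARD('a::{field,finite})"
  using card_mono[of "UNIV::'a set" "{0,1}"] by simp

lemma dim_eqI_card:
  fixes U :: "('a::{field,finite} ^ 'n::finite) set"
  assumes "vec.subspace U" "card U = CARD('a) ^ d"
  shows "vec.dim U = d"
  using card_subspace[OF assms(1)] assms(2) CARD_field_gt_1[where 'a='a] by simp

lemma card_coordinate_subspace:
  "card {x :: 'a::field ^ 'n::finite. \<forall>i\<in>I. x $ i = 0} = CARD('a) ^ (CARD('n) - card I)"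
proof -
  have "bij_betw (\<lambda>x. restrict (($) x) (- I)) {x :: 'a ^ 'n. \<forall>i\<in>I. x $ i = 0} (- I \<rightarrow>\<^sub>E UNIV)"
    by (rule bij_betw_byWitness[where f' = "\<lambda>f. \<chi> i. if i \<in> I then 0 else f i"])
       (auto simp: vec_eq_iff fun_eq_iff PiE_def extensional_def)
  from bij_betw_same_card[OF this] show ?thesis
    by (simp add: card_PiE Compl_eq_Diff_UNIV card_Diff_subset)
qed

section \<open>Subspace distance in terms of dimensions\<close>

lemma dim_span_Un_Int:
  fixes X Y :: "('a::field ^ 'n::finite) set"
  assumes "vec.subspace X" "vec.subspace Y"
  shows "vec.dim (vec.span (X \<union> Y)) + vec.dim (X \<inter> Y) = vec.dim X + vec.dim Y"
  using vec.dim_sums_Int[OF assms] assms by (simp add: vec.span_Un vec.span_eq_iff[THEN iffD2] del: vec.dim_span)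

lemma dim_le_CARD: "vec.dim (X :: ('a::field ^ 'n::finite) set) \<le> CARD('n)"
  using vec.dim_subset[of X UNIV] by (simp add: vec_dim_card card_cart_basis)

text \<open>For v the ambient dimension, only the values (v, 0), (v, 1) and (v - 1, 0) of (dim(X +
  Y), dim(X \<inter> Y)) give distance at least v - 1. The truncated subtraction covers all three:
  it yields 0 also when the dimensions add up to v - 1.\<close>

lemma sdist_ge_iff:
  fixes X Y :: "('a::field ^ 'n::finite) set"
  assumes "vec.subspace X" "vec.subspace Y"
  shows "CARD('n) - 1 \<le> sdist X Y \<longleftrightarrow>
    CARD('n) \<le> vec.dim X + vec.dim Y + 1 \<and> vec.dim X + vec.dim Y \<le> CARD('n) + 1 \<and>
    vec.dim (X \<inter> Y) = vec.dim X + vec.dim Y - CARD('n)"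
proof -
  have "CARD('n) > 0" by simp
  moreover have "vec.dim (vec.span (X \<union> Y)) \<le> CARD('n)" by (rule dim_le_CARD)
  moreover have "vec.dim (X \<inter> Y) \<le> vec.dim (vec.span (X \<union> Y))"
    by (intro vec.dim_subset) (auto intro: vec.span_base)
  moreover have arith: "N - 1 \<le> s - i \<longleftrightarrow> N \<le> x + y + 1 \<and> x + y \<le> N + 1 \<and> i = x + y - N"
    if "N > 0" "s \<le> N" "i \<le> s" "s + i = x + y" for N s i x y :: nat
    using that by linarith
  ultimately show ?thesis
    using arith[of "CARD('n)" "vec.dim (vec.span (X \<union> Y))"] dim_span_Un_Int[OF assms]
    unfolding sdist_def by blast
qed

lemma dim_eq_0_subspace:
  fixes X :: "('a::field ^ 'n::finite) set"
  shows "vec.subspace X \<Longrightarrow> vec.dim X = 0 \<longleftrightarrow> X = {0}"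
  using vec.dim_eq_0[of X] vec.subspace_0[of X] by auto

subsection \<open>Duality\<close>

text \<open>The orthogonal complement for the standard bilinear form. Over a finite field a subspace
  may meet its complement nontrivially, so the dimension of the complement cannot come from a direct
  sum decomposition.\<close>

definition perp :: "('a::field ^ 'n::finite) set \<Rightarrow> ('a ^ 'n) set" where
  "perp U = {c. \<forall>x\<in>U. (\<Sum>i\<in>UNIV. c $ i * x $ i) = 0}"

lemma subspace_perp: "vec.subspace (perp U)"
  unfolding vec.subspace_def perp_def
  by (auto simp: algebra_simps sum.distrib simp flip: sum_distrib_left)

lemma perp_span: "perp (vec.span B) = perp B"
proof
  show "perp (vec.span B) \<subseteq> perp B"
    unfolding perp_def using vec.span_base by blast
  show "perp B \<subseteq> perp (vec.span B)"
  proof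
    fix c assume c: "c \<in> perp B"
    have "vec.subspace {x. (\<Sum>i\<in>UNIV. c $ i * x $ i) = 0}"
      unfolding vec.subspace_def
      by (auto simp: algebra_simps sum.distrib mult.left_commute simp flip: sum_distrib_left)
    moreover have "B \<subseteq> {x. (\<Sum>i\<in>UNIV. c $ i * x $ i) = 0}" using c by (auto simp: perp_def)
    ultimately have "vec.span B \<subseteq> {x. (\<Sum>i\<in>UNIV. c $ i * x $ i) = 0}" by (rule vec.span_minimal[rotated])
    then show "c \<in> perp (vec.span B)" by (auto simp: perp_def)
  qed
qed

lemma perp_UNIV: "perp UNIV = {0 :: 'a::field ^ 'n::finite}"
proof -
  have "c = 0" if c: "c \<in> perp UNIV" for c :: "'a ^ 'n"
  proof -
    have "(\<Sum>i\<in>UNIV. c $ i * axis j 1 $ i) = 0" for j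
      using c by (auto simp: perp_def)
    then have "c $ j = 0" for j by (simp add: axis_def if_distrib cong: if_cong)
    then show ?thesis by (simp add: vec_eq_iff)
  qed
  then show ?thesis by (auto simp: perp_def)
qed

text \<open>Extend a basis of \<open>U\<close> to a basis of the whole space and let
  \<open>T\<close> record the products of a vector with all basis vectors. \<open>T\<close> is
  injective since only 0 is orthogonal to everything, hence bijective by finiteness, and it turns
  \<open>perp U\<close> into the vectors whose coordinates at the basis of \<open>U\<close>
  vanish.\<close>

lemma card_perp:
  fixes U :: "('a::{field,finite} ^ 'n::finite) set"
  assumes "vec.subspace U"
  shows "card (perp U) = CARD('a) ^ (CARD('n) - vec.dim U)"
proof -
  obtain B where B: "B \<subseteq> U" "vec.independent B" "U \<subseteq> vec.span B" "card B = vec.dim U"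
    using vec.basis_exists by blast
  then have spB: "vec.span B = U" using assms vec.span_minimal by blast
  obtain E where E: "B \<subseteq> E" "vec.independent E" "UNIV \<subseteq> vec.span E"
    using vec.maximal_independent_subset_extend[of B UNIV] B(2) by auto
  have "card E = CARD('n)" 
    using vec.basis_card_eq_dim[of E UNIV] E by (simp add: vec_dim_card card_cart_basis)
  then obtain h :: "'n \<Rightarrow> 'a ^ 'n" where h: "bij_betw h UNIV E"
    by (metis finite finite_same_card_bij)
  define T where "T c = (\<chi> i. \<Sum>j\<in>UNIV. c $ j * h i $ j)" for c :: "'a ^ 'n"
  define I where "I = {i. h i \<in> B}"
  have "bij_betw h I B" using h E(1) unfolding I_def bij_betw_def
    by (auto simp: inj_on_def)
  then have cI: "card I = vec.dim U" using B(4) bij_betw_same_card by metis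
  have "inj T"
  proof (rule injI)
    fix c d assume "T c = T d"
    then have "\<forall>i. (\<Sum>j\<in>UNIV. (c - d) $ j * h i $ j) = 0"
      by (simp add: T_def vec_eq_iff sum_subtractf algebra_simps)
    then have "c - d \<in> perp E" using h unfolding perp_def bij_betw_def by auto
    then have "c - d \<in> perp (vec.span E)" by (simp add: perp_span)
    moreover have "vec.span E = UNIV" using E(3) by auto
    ultimately show "c = d" by (simp add: perp_UNIV)
  qed
  then have "bij T" by (simp add: finite_UNIV_inj_surj bij_betw_def)
  have "perp U = T -` {x. \<forall>i\<in>I. x $ i = 0}"
  proof -
    have B_eq: "B = h ` I" using \<open>bij_betw h I B\<close> by (simp add: bij_betw_def)
    have "perp U = perp B" using perp_span[of B] by (simp add: spB)
    then show ?thesis unfolding B_eq by (auto simp: perp_def T_def)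
  qed
  then have "card (perp U) = card {x :: 'a ^ 'n. \<forall>i\<in>I. x $ i = 0}"
    using card_vimage_inj[OF bij_is_inj[OF \<open>bij T\<close>], of "{x. \<forall>i\<in>I. x $ i = 0}"]
      bij_is_surj[OF \<open>bij T\<close>] by simp
  then show ?thesis by (simp add: card_coordinate_subspace cI)
qed

lemma dim_perp:
  fixes U :: "('a::{field,finite} ^ 'n::finite) set"
  assumes "vec.subspace U"
  shows "vec.dim (perp U) = CARD('n) - vec.dim U"
  using dim_eqI_card[OF subspace_perp card_perp[OF assms]] .

lemma perp_perp:
  fixes U :: "('a::{field,finite} ^ 'n::finite) set"
  assumes "vec.subspace U"
  shows "perp (perp U) = U"
proof -
  have "U \<subseteq> perp (perp U)" by (auto simp: perp_def mult.commute)
  moreover have "vec.dim (perp (perp U)) = vec.dim U"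
    using assms dim_le_CARD[of U] by (simp add: dim_perp subspace_perp)
  ultimately show ?thesis
    using vec.subspace_dim_equal[OF assms subspace_perp, of "perp U"] by simp
qed

lemma perp_span_Un:
  assumes "vec.subspace X" "vec.subspace Y"
  shows "perp (vec.span (X \<union> Y)) = perp X \<inter> perp Y"
  unfolding perp_span by (auto simp: perp_def)

text \<open>Complementation sends X + Y to the intersection of the complements, of dimension v -
  dim(X + Y). The dimension formula then determines the sum of the complements, and the difference
  is unchanged.\<close>

lemma sdist_perp:
  fixes X Y :: "('a::{field,finite} ^ 'n::finite) set"
  assumes "vec.subspace X" "vec.subspace Y"
  shows "sdist (perp X) (perp Y) = sdist X Y"
proof -
  have "vec.dim (perp X \<inter> perp Y) = CARD('n) - vec.dim (vec.span (X \<union> Y))"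
    using dim_perp perp_span_Un[OF assms] vec.subspace_span by metis
  moreover have "vec.dim (vec.span (X \<union> Y)) \<le> CARD('n)" by (rule dim_le_CARD)
  moreover have "vec.dim (X \<inter> Y) \<le> vec.dim (vec.span (X \<union> Y))"
    by (intro vec.dim_subset) (auto intro: vec.span_base)
  moreover have "vec.dim (vec.span (perp X \<union> perp Y)) + vec.dim (perp X \<inter> perp Y)
      = (CARD('n) - vec.dim X) + (CARD('n) - vec.dim Y)"
    using dim_span_Un_Int[OF subspace_perp subspace_perp, of X Y] by (simp only: dim_perp assms)
  moreover have arith: "s' - (N - s) = s - i"
    if "s \<le> N" "i \<le> s" "s' + (N - s) = (N - x) + (N - y)" "s + i = x + y" "x \<le> N" "y \<le> N"
    for N s s' i x y :: nat
    using that by linarith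
  ultimately show ?thesis
    using arith[OF _ _ _ dim_span_Un_Int[OF assms] dim_le_CARD dim_le_CARD]
    unfolding sdist_def by (metis (no_types))
qed

lemma inj_on_perp: "inj_on perp (Collect vec.subspace :: ('a::{field,finite} ^ 'n::finite) set set)"
  by (rule inj_on_inverseI[of _ perp]) (simp add: perp_perp)

lemma is_code_perp:
  fixes C :: "('a::{field,finite} ^ 'n::finite) set set"
  assumes "is_code C d"
  shows "is_code (perp ` C) d"
  using assms unfolding is_code_def subspaces_def
  by (auto simp: subspace_perp sdist_perp subset_iff)

lemma card_perp_image:
  fixes C :: "('a::{field,finite} ^ 'n::finite) set set"
  assumes "C \<subseteq> subspaces"
  shows "card (perp ` C) = card C"
  using assms inj_on_perp by (intro card_image) (auto simp: subspaces_def intro: inj_on_subset)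

lemma dim_distr_perp:
  fixes C :: "('a::{field,finite} ^ 'n::finite) set set"
  assumes "C \<subseteq> subspaces" "t \<le> CARD('n)"
  shows "dim_distr (perp ` C) t = dim_distr C (CARD('n) - t)"
proof -
  have "{U \<in> perp ` C. vec.dim U = t} = perp ` {U \<in> C. vec.dim U = CARD('n) - t}"
  proof -
    have "vec.dim (perp U) = t \<longleftrightarrow> vec.dim U = CARD('n) - t" if "U \<in> C" for U
      using that assms dim_perp[of U] dim_le_CARD[of U] by (auto simp: subspaces_def)
    then show ?thesis by auto
  qed
  moreover have "{U \<in> C. vec.dim U = CARD('n) - t} \<subseteq> subspaces" using assms(1) by blast
  ultimately show ?thesis unfolding dim_distr_def by (simp add: card_perp_image)
qed

subsection \<open>Codes in even dimension\<close>

lemma card_subspace_Diff: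
  fixes U W :: "('a::{field,finite} ^ 'n::finite) set"
  assumes "vec.subspace U" "vec.subspace W"
  shows "card (U - W) = CARD('a) ^ vec.dim U - CARD('a) ^ vec.dim (U \<inter> W)"
  using card_subspace[OF assms(1)] card_subspace[OF vec.subspace_inter[OF assms]]
  by (simp add: card_Diff_subset_Int)

lemma card_subspace_nonzero:
  fixes U :: "('a::{field,finite} ^ 'n::finite) set"
  assumes "vec.subspace U"
  shows "card (U - {0}) = CARD('a) ^ vec.dim U - 1"
  using card_subspace_Diff[OF assms vec.subspace_single_0] vec.subspace_0[OF assms] by simp

text \<open>The packing bound behind all vector counts: words that meet only inside \<open>W\<close>
  are disjoint outside it. It is applied with \<open>W\<close> trivial and with \<open>W\<close> a
  large word, and \<open>H\<close> is the whole space or a hyperplane.\<close>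

lemma sum_card_Diff_le:
  fixes C :: "('a::{field,finite} ^ 'n::finite) set set"
  assumes "\<And>U V. U \<in> C \<Longrightarrow> V \<in> C \<Longrightarrow> U \<noteq> V \<Longrightarrow> U \<inter> V \<subseteq> W"
    and "\<And>U. U \<in> C \<Longrightarrow> U \<subseteq> H"
  shows "(\<Sum>U\<in>C. card (U - W)) \<le> card (H - W)"
proof -
  have "(\<Sum>U\<in>C. card (U - W)) = card (\<Union>U\<in>C. U - W)"
    using assms(1) by (intro card_UN_disjoint[symmetric]) auto
  also have "\<dots> \<le> card (H - W)" using assms(2) by (intro card_mono) auto
  finally show ?thesis .
qed

lemma dim_UNIV_vec: "vec.dim (UNIV :: ('a::field ^ 'n::finite) set) = CARD('n)"
  by (simp add: vec_dim_card card_cart_basis)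

section \<open>Words of a code of distance at least v - 1\<close>

lemma code_pair:
  fixes C :: "('a::{field,finite} ^ 'n::finite) set set"
  assumes "is_code C (CARD('n) - 1)" "X \<in> C" "Y \<in> C" "X \<noteq> Y"
  shows "CARD('n) \<le> vec.dim X + vec.dim Y + 1" "vec.dim X + vec.dim Y \<le> CARD('n) + 1"
    "vec.dim (X \<inter> Y) = vec.dim X + vec.dim Y - CARD('n)"
proof -
  have "vec.subspace X" "vec.subspace Y" "CARD('n) - 1 \<le> sdist X Y"
    using assms by (auto simp: is_code_def subspaces_def)
  then show "CARD('n) \<le> vec.dim X + vec.dim Y + 1" "vec.dim X + vec.dim Y \<le> CARD('n) + 1"
    "vec.dim (X \<inter> Y) = vec.dim X + vec.dim Y - CARD('n)"
    using sdist_ge_iff[of X Y] by blast+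
qed

lemma code_pair_disjoint:
  fixes C :: "('a::{field,finite} ^ 'n::finite) set set"
  assumes "is_code C (CARD('n) - 1)" "X \<in> C" "Y \<in> C" "X \<noteq> Y" "vec.dim X + vec.dim Y \<le> CARD('n)"
  shows "X \<inter> Y = {0}"
proof -
  have "vec.subspace X" "vec.subspace Y" using assms(1-3) by (auto simp: is_code_def subspaces_def)
  then have "vec.subspace (X \<inter> Y)" by (rule vec.subspace_inter)
  moreover have "vec.dim (X \<inter> Y) = 0" using code_pair(3)[OF assms(1-4)] assms(5) by simp
  ultimately show ?thesis using dim_eq_0_subspace by blast
qed

lemma code_subspace: "is_code C d \<Longrightarrow> X \<in> C \<Longrightarrow> vec.subspace X"
  by (auto simp: is_code_def subspaces_def)

text \<open>\<open>X\<close> and \<open>Y\<close> may coincide, so the same lemma supplies both the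
  second and the third word.\<close>

lemma third_word:
  assumes "3 \<le> card C"
  obtains Z where "Z \<in> C" "Z \<noteq> X" "Z \<noteq> Y"
proof -
  have "\<not> C \<subseteq> {X, Y}"
  proof
    assume "C \<subseteq> {X, Y}"
    then have "card C \<le> card {X, Y}" by (rule card_mono[rotated]) simp
    then show False using assms card_insert_le_m1[of 2 "{Y}" X] by simp
  qed
  then show thesis using that by blast
qed

text \<open>Two such words would have dimension sum 2t, outside the range from v - 1 to v +
  1.\<close>

lemma card_le_1_same_dim:
  fixes C :: "('a::{field,finite} ^ 'n::finite) set set"
  assumes "is_code C (CARD('n) - 1)" "2 * t + 1 < CARD('n) \<or> CARD('n) + 1 < 2 * t"
  shows "card {U \<in> C. vec.dim U = t} \<le> 1"
proof -
  have "X = Y" if "X \<in> {U \<in> C. vec.dim U = t}" "Y \<in> {U \<in> C. vec.dim U = t}" for X Y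
    using code_pair(1,2)[OF assms(1), of X Y] that assms(2) by fastforce
  then show ?thesis by (simp add: card_le_Suc0_iff_eq)
qed

text \<open>The capacity \<open>N * u\<close> is a multiple of the weight \<open>u\<close> of an
  ordinary word, so one exceptional word of any positive weight \<open>c\<close> already displaces a
  whole ordinary word.\<close>

lemma le_of_weighted_count:
  fixes a b c u N :: nat
  assumes "b * u + a * c \<le> N * u" "0 < u" "0 < c" "a \<le> 1"
  shows "a + b \<le> N"
proof (cases "a = 0")
  case False
  then have "a = 1" using assms(4) by simp
  then have "b * u + c \<le> N * u" using assms(1) by (simp only: mult_1)
  then have "b * u < N * u" using assms(3) by linarith
  then show ?thesis using False assms(4) by simp
qed (use assms in simp)

text \<open>With two further words Y and Z, 2 dim X equals (dim X + dim Y) + (dim X + dim Z) - (dim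
  Y + dim Z). Each bracket is within 1 of 2k, so 2 dim X lies between 2k - 3 and 2k + 3. Two words
  would not suffice: dimensions 0 and v are compatible.\<close>

lemma even_code_dims:
  fixes C :: "('a::{field,finite} ^ 'n::finite) set set"
  assumes "is_code C (CARD('n) - 1)" "CARD('n) = 2 * k" "3 \<le> card C" "X \<in> C"
  shows "vec.dim X \<in> {k - 1, k, k + 1}"
proof -
  obtain Y where "Y \<in> C" "Y \<noteq> X" using third_word[OF assms(3), of X X] .
  moreover obtain Z where "Z \<in> C" "Z \<noteq> X" "Z \<noteq> Y" using third_word[OF assms(3), of X Y] .
  ultimately have YZ: "Y \<in> C" "Z \<in> C" "X \<noteq> Y" "X \<noteq> Z" "Y \<noteq> Z" by auto
  from code_pair(1,2)[OF assms(1,4) YZ(1,3)] code_pair(1,2)[OF assms(1,4) YZ(2,4)]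
    code_pair(1,2)[OF assms(1) YZ(1,2,5)] assms(2)
  show ?thesis by simp linarith
qed

text \<open>Words of dimension k - 1 and k meet pairwise in 0, and there are (q^k + 1)(q^k - 1)
  nonzero vectors to share. A word \<open>W\<close> of dimension k + 1 meets each k-word in
  dimension 1, so in its presence only the q^k (q^k - q) vectors outside \<open>W\<close> are
  shared. Each k-word takes q^k - q of them; this leaves room for q^k words besides
  \<open>W\<close>.\<close>

lemma even_code_bound:
  fixes C :: "('a::{field,finite} ^ 'n::finite) set set"
  assumes code: "is_code C (CARD('n) - 1)" and n: "CARD('n) = 2 * k" and k: "2 \<le> k"
    and dims: "\<And>X. X \<in> C \<Longrightarrow> vec.dim X \<in> {k - 1, k, k + 1}"
  shows "card C \<le> CARD('a) ^ k + 1"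
proof -
  let ?q = "CARD('a)"
  define A where "A = {U \<in> C. vec.dim U = k - 1}"
  define B where "B = {U \<in> C. vec.dim U = k}"
  define D where "D = {U \<in> C. vec.dim U = k + 1}"
  have C: "C = A \<union> B \<union> D" using dims by (auto simp: A_def B_def D_def)
  have q: "1 < ?q" by (rule CARD_field_gt_1)
  have disj: "A \<inter> B = {}" "(A \<union> B) \<inter> D = {}" using k by (auto simp: A_def B_def D_def)
  then have card_C: "card C = card A + card B + card D"
    unfolding C by (simp add: card_Un_disjoint)
  have A1: "card A \<le> 1" unfolding A_def by (rule card_le_1_same_dim[OF code]) (use n k in arith)
  have D1: "card D \<le> 1" unfolding D_def by (rule card_le_1_same_dim[OF code]) (use n k in arith)
  have sub: "vec.subspace U" if "U \<in> C" for U using code_subspace[OF code that] .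
  have pair: "U \<inter> V = {0}" if "U \<in> A \<union> B" "V \<in> A \<union> B" "U \<noteq> V" for U V
  proof -
    have "U \<in> C" "V \<in> C" "vec.dim U \<le> k" "vec.dim V \<le> k" using that by (auto simp: A_def B_def)
    then show ?thesis using code_pair_disjoint[OF code \<open>U \<in> C\<close> \<open>V \<in> C\<close> that(3)] n by linarith
  qed
  show ?thesis
  proof (cases "D = {}")
    case True
    have "(\<Sum>U\<in>A \<union> B. card (U - {0})) \<le> card ((UNIV :: ('a ^ 'n) set) - {0})"
      by (rule sum_card_Diff_le) (use pair in auto)
    also have "card ((UNIV :: ('a ^ 'n) set) - {0}) = (?q ^ k + 1) * (?q ^ k - 1)"
    proof -
      have "card ((UNIV :: ('a ^ 'n) set) - {0}) = ?q ^ (2 * k) - 1"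
        using card_subspace_nonzero[OF vec.subspace_UNIV, where 'a='a and 'n='n]
        unfolding dim_UNIV_vec n .
      moreover have "?q ^ (2 * k) = ?q ^ k * ?q ^ k" by (simp add: mult_2 power_add)
      ultimately show ?thesis by (simp add: diff_mult_distrib2)
    qed
    also have "(\<Sum>U\<in>A \<union> B. card (U - {0})) = (\<Sum>U\<in>A. card (U - {0})) + (\<Sum>U\<in>B. card (U - {0}))"
      using disj by (intro sum.union_disjoint) auto
    also have "(\<Sum>U\<in>A. card (U - {0})) = card A * (?q ^ (k - 1) - 1)"
    proof -
      have "card (U - {0}) = ?q ^ (k - 1) - 1" if "U \<in> A" for U
        using that card_subspace_nonzero[OF sub[of U]] by (simp add: A_def)
      then show ?thesis by simp
    qed
    also have "(\<Sum>U\<in>B. card (U - {0})) = card B * (?q ^ k - 1)"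
    proof -
      have "card (U - {0}) = ?q ^ k - 1" if "U \<in> B" for U
        using that card_subspace_nonzero[OF sub[of U]] by (simp add: B_def)
      then show ?thesis by simp
    qed
    finally have cnt: "card B * (?q ^ k - 1) + card A * (?q ^ (k - 1) - 1) \<le> (?q ^ k + 1) * (?q ^ k - 1)"
      by simp
    \<comment> \<open>Here k must be at least 2: a (k-1)-word has to contain a nonzero vector in
      order to cost anything.\<close>
    have pos: "0 < ?q ^ k - 1" "0 < ?q ^ (k - 1) - 1"
      using q k one_less_power[OF q, of k] one_less_power[OF q, of "k - 1"] by simp_all
    have "card A + card B \<le> ?q ^ k + 1" by (rule le_of_weighted_count[OF cnt pos A1])
    then show ?thesis using card_C True by simp
  next
    case False
    then obtain W where W: "W \<in> D" by blast
    have W_sub: "vec.subspace W" and W_dim: "vec.dim W = k + 1" and "W \<in> C"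
      using W sub by (auto simp: D_def)
    have "0 \<in> W" using vec.subspace_0[OF W_sub] .
    have "(\<Sum>U\<in>A \<union> B. card (U - W)) \<le> card (UNIV - W)"
    proof (rule sum_card_Diff_le)
      show "U \<inter> V \<subseteq> W" if "U \<in> A \<union> B" "V \<in> A \<union> B" "U \<noteq> V" for U V
        using pair[OF that] \<open>0 \<in> W\<close> by simp
    qed simp
    also have "card (UNIV - W) = ?q ^ k * (?q ^ k - ?q)"
    proof -
      have "card (UNIV - W) = ?q ^ (2 * k) - ?q ^ (k + 1)"
        using card_subspace_Diff[OF vec.subspace_UNIV W_sub]
        by (simp only: dim_UNIV_vec n W_dim Int_UNIV_left)
      moreover have "?q ^ (2 * k) = ?q ^ k * ?q ^ k" by (simp add: mult_2 power_add)
      ultimately show ?thesis by (simp add: diff_mult_distrib2 mult.commute)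
    qed
    also have "(\<Sum>U\<in>A \<union> B. card (U - W)) = (\<Sum>U\<in>A. card (U - W)) + (\<Sum>U\<in>B. card (U - W))"
      using disj by (intro sum.union_disjoint) auto
    also have "(\<Sum>U\<in>A. card (U - W)) = card A * (?q ^ (k - 1) - 1)"
    proof -
      have "card (U - W) = ?q ^ (k - 1) - 1" if "U \<in> A" for U
      proof -
        have U: "U \<in> C" "vec.dim U = k - 1" using that by (auto simp: A_def)
        have UW: "vec.dim (U \<inter> W) = 0"
          using code_pair(3)[OF code \<open>U \<in> C\<close> \<open>W \<in> C\<close>] U(2) W_dim n k by force
        show ?thesis using card_subspace_Diff[OF sub[OF U(1)] W_sub] unfolding U(2) UW by simp
      qed
      then show ?thesis by simp
    qed
    also have "(\<Sum>U\<in>B. card (U - W)) = card B * (?q ^ k - ?q)"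
    proof -
      have "card (U - W) = ?q ^ k - ?q" if "U \<in> B" for U
      proof -
        have U: "U \<in> C" "vec.dim U = k" using that by (auto simp: B_def)
        have UW: "vec.dim (U \<inter> W) = 1"
          using code_pair(3)[OF code \<open>U \<in> C\<close> \<open>W \<in> C\<close>] U(2) W_dim n k by force
        show ?thesis using card_subspace_Diff[OF sub[OF U(1)] W_sub] unfolding U(2) UW by simp
      qed
      then show ?thesis by simp
    qed
    finally have cnt: "card B * (?q ^ k - ?q) + card A * (?q ^ (k - 1) - 1) \<le> ?q ^ k * (?q ^ k - ?q)"
      by simp
    have pos: "0 < ?q ^ k - ?q" "0 < ?q ^ (k - 1) - 1"
      using q k power_strict_increasing[of 1 k ?q] one_less_power[OF q, of "k - 1"] by simp_all
    have "card A + card B \<le> ?q ^ k" by (rule le_of_weighted_count[OF cnt pos A1])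
    then show ?thesis using card_C D1 by simp
  qed
qed

subsection \<open>Partial spreads in odd dimension\<close>

text \<open>
  Here r = q ^ (k - 1), and N is the number of words inside a hyperplane when there are
  q ^ (k + 1) + 2 words in total; the remaining words meet the hyperplane in dimension at least k - 1.
\<close>

lemma partial_spread_hyperplane_bound:
  fixes q r N :: nat
  assumes "2 \<le> q" "2 \<le> r" "N \<le> q * q * r + 2"
    "N * (q * r - 1) + (q * q * r + 2 - N) * (r - 1) \<le> q * q * r * r - 1"
  shows "N \<le> q"
proof (rule ccontr)
  assume "\<not> N \<le> q"
  \<comment> \<open>The excess over q + 1. Since (q + 1)(q - 1) = q^2 - 1, all large terms cancel
    and d (q - 1) r + r \<le> 1 remains.\<close>
  define d where "d = N - (q + 1)"
  have N: "N = q + 1 + d" using \<open>\<not> N \<le> q\<close> by (simp add: d_def)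
  have "r \<le> q * r" using assms by simp
  define M where "M = q * q * r + 2 - N"
  have M: "int M = int q * int q * int r + 2 - int N" using assms(3) by (simp add: M_def of_nat_diff)
  have "int (N * (q * r - 1) + M * (r - 1)) \<le> int (q * q * r * r - 1)"
    using assms(4) unfolding M_def by (rule of_nat_mono)
  moreover have "1 \<le> q * r" "1 \<le> r" "1 \<le> q * q * r * r" using assms(1,2) by auto
  ultimately have "int N * (int q * int r - 1) + int M * (int r - 1) \<le> int q * int q * int r * int r - 1"
    by (simp add: of_nat_diff)
  then have "int d * (int q * int r - int r) + int r \<le> 1"
    unfolding M unfolding N by (simp add: algebra_simps)
  moreover have "0 \<le> int d * (int q * int r - int r)"
    using assms(1) by (intro mult_nonneg_nonneg) (simp_all add: mult_le_cancel_right1)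
  ultimately show False using assms(2) by linarith
qed

text \<open>Suppose that there are q^(k+1) + 2 words. Then every hyperplane contains at most q of
  them, while each word lies in a fixed number of hyperplanes; counting the incidences in both ways
  gives too many.\<close>

lemma partial_spread_bound:
  fixes P :: "('a::{field,finite} ^ 'n::finite) set set"
  assumes n: "CARD('n) = 2 * k + 1" and k: "2 \<le> k"
    and sub: "\<And>U. U \<in> P \<Longrightarrow> vec.subspace U" and dim: "\<And>U. U \<in> P \<Longrightarrow> vec.dim U = k"
    and disj: "\<And>U V. U \<in> P \<Longrightarrow> V \<in> P \<Longrightarrow> U \<noteq> V \<Longrightarrow> U \<inter> V = {0}"
  shows "card P \<le> CARD('a) ^ (k + 1) + 1"
proof (rule ccontr)
  let ?q = "CARD('a)"
  let ?Q = "?q ^ (k + 1)"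
  assume "\<not> card P \<le> ?Q + 1"
  then obtain P' where P': "P' \<subseteq> P" "card P' = ?Q + 2"
    using obtain_subset_with_card_n[of "?Q + 2" P] by auto
  have q: "1 < ?q" by (rule CARD_field_gt_1)
  define r where "r = ?q ^ (k - 1)"
  have r: "2 \<le> r" using one_less_power[OF q, of "k - 1"] k by (simp add: r_def)
  have qk: "?q ^ k = ?q * r" using k by (simp add: r_def flip: power_Suc)
  then have Q: "?Q = ?q * ?q * r" by simp
  have dim_H: "vec.dim (perp {c}) = 2 * k" if "c \<noteq> 0" for c :: "'a ^ 'n"
    using dim_perp[OF vec.subspace_span, of "{c}"] that n by (simp add: perp_span)
  have le_q: "card {U \<in> P'. c \<in> perp U} \<le> ?q" if "c \<noteq> 0" for c
  proof -
    let ?H = "perp {c}"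
    define N where "N = {U \<in> P'. c \<in> perp U}"
    have c_perp: "c \<in> perp U \<longleftrightarrow> U \<subseteq> ?H" for U by (auto simp: perp_def mult.commute)
    have ge: "r - 1 \<le> card (U \<inter> ?H - {0})" if "U \<in> P'" for U
    proof -
      have U: "vec.subspace U" "vec.dim U = k" using that P'(1) sub dim by auto
      have "vec.dim (vec.span (U \<union> ?H)) \<le> 2 * k + 1" using dim_le_CARD[of "vec.span (U \<union> ?H)"] n by simp
      then have "k - 1 \<le> vec.dim (U \<inter> ?H)"
        using dim_span_Un_Int[OF U(1) subspace_perp, of "{c}"] U(2) dim_H[OF \<open>c \<noteq> 0\<close>] by linarith
      then have "r \<le> ?q ^ vec.dim (U \<inter> ?H)" unfolding r_def using q by (intro power_increasing) auto
      then show ?thesis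
        using card_subspace_nonzero[OF vec.subspace_inter[OF U(1) subspace_perp]] by (metis diff_le_mono)
    qed
    have eq: "card (U \<inter> ?H - {0}) = ?q * r - 1" if "U \<in> N" for U
    proof -
      have "U \<inter> ?H = U" "vec.subspace U" "vec.dim U = k"
        using that P'(1) sub dim c_perp by (auto simp: N_def)
      then show ?thesis using card_subspace_nonzero[of U] qk by simp
    qed
    have N_sub: "N \<subseteq> P'" by (auto simp: N_def)
    \<comment> \<open>The packing bound speaks of a set of subspaces, so distinct words need
      distinct traces on the hyperplane. The traces of distinct words meet in 0, and each trace is
      nonzero because r \<ge> 2.\<close>
    have inj: "inj_on (\<lambda>U. U \<inter> ?H) P'"
    proof (rule inj_onI)
      fix U V assume UV: "U \<in> P'" "V \<in> P'" "U \<inter> ?H = V \<inter> ?H"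
      show "U = V"
      proof (rule ccontr)
        assume "U \<noteq> V"
        then have "U \<inter> ?H - {0} = {}" using disj[of U V] UV P'(1) by blast
        then have "card (U \<inter> ?H - {0}) = 0" by (simp only: card.empty)
        then show False using ge[OF UV(1)] r by linarith
      qed
    qed
    have "(\<Sum>U\<in>P'. card (U \<inter> ?H - {0})) = (\<Sum>U\<in>(\<lambda>U. U \<inter> ?H) ` P'. card (U - {0}))"
      by (simp add: sum.reindex[OF inj])
    also have "\<dots> \<le> card (?H - {0})"
      by (rule sum_card_Diff_le) (use disj P'(1) in blast)+
    also have "\<dots> = ?q * ?q * r * r - 1"
    proof -
      have "?q ^ (2 * k) = ?q * ?q * r * r" using qk by (simp add: mult_2 power_add)
      then show ?thesis using card_subspace_nonzero[OF subspace_perp, of "{c}"] dim_H[OF that] by simp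
    qed
    finally have le: "(\<Sum>U\<in>P'. card (U \<inter> ?H - {0})) \<le> ?q * ?q * r * r - 1" .
    have "(\<Sum>U\<in>P'. card (U \<inter> ?H - {0}))
        = (\<Sum>U\<in>N. card (U \<inter> ?H - {0})) + (\<Sum>U\<in>P' - N. card (U \<inter> ?H - {0}))"
      using sum.subset_diff[OF N_sub, of "\<lambda>U. card (U \<inter> ?H - {0})"] by simp
    moreover have "(\<Sum>U\<in>N. card (U \<inter> ?H - {0})) = card N * (?q * r - 1)" by (simp add: eq)
    moreover have "card (P' - N) * (r - 1) \<le> (\<Sum>U\<in>P' - N. card (U \<inter> ?H - {0}))"
      using sum_bounded_below[of "P' - N" "r - 1" "\<lambda>U. card (U \<inter> ?H - {0})"] ge by simp
    moreover have "card (P' - N) = ?q * ?q * r + 2 - card N"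
      using N_sub P'(2) Q by (simp add: card_Diff_subset)
    ultimately have "card N * (?q * r - 1) + (?q * ?q * r + 2 - card N) * (r - 1) \<le> ?q * ?q * r * r - 1"
      using le by simp
    moreover have "card N \<le> ?q * ?q * r + 2" using card_mono[OF _ N_sub] P'(2) Q by simp
    ultimately show ?thesis
      using partial_spread_hyperplane_bound[of ?q r "card N"] q r by (simp add: N_def)
  qed
  \<comment> \<open>Hyperplanes are represented by their normal vectors c, so each one is counted q
    - 1 times on both sides.\<close>
  have "(\<Sum>c\<in>UNIV - {0}. card {U \<in> P'. c \<in> perp U}) = (\<Sum>U\<in>P'. card {c \<in> UNIV - {0}. c \<in> perp U})"
    by (rule sum_multicount_gen[symmetric]) auto
  also have "\<dots> = (\<Sum>U\<in>P'. ?Q - 1)"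
  proof (rule sum.cong[OF refl])
    fix U assume "U \<in> P'"
    then have "vec.dim (perp U) = k + 1" using P'(1) sub dim dim_perp[of U] n by auto
    moreover have "{c \<in> UNIV - {0}. c \<in> perp U} = perp U - {0}" by auto
    ultimately show "card {c \<in> UNIV - {0}. c \<in> perp U} = ?Q - 1"
      using card_subspace_nonzero[OF subspace_perp, of U] by simp
  qed
  also have "\<dots> = (?Q + 2) * (?Q - 1)" using P'(2) by simp
  finally have "(?Q + 2) * (?Q - 1) \<le> card ((UNIV :: ('a ^ 'n) set) - {0}) * ?q"
    using sum_bounded_above[of "UNIV - {0}" "\<lambda>c. card {U \<in> P'. c \<in> perp U}" ?q] le_q by simp
  also have "card ((UNIV :: ('a ^ 'n) set) - {0}) * ?q = ?Q * ?Q - ?q"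
  proof -
    have "card ((UNIV :: ('a ^ 'n) set) - {0}) = ?q ^ (2 * k + 1) - 1"
      using card_subspace_nonzero[OF vec.subspace_UNIV, where 'a='a and 'n='n]
      unfolding dim_UNIV_vec n .
    moreover have "?q ^ (2 * k + 1) * ?q = ?Q * ?Q" by (simp add: power_add mult_2)
    ultimately show ?thesis by (simp only: diff_mult_distrib mult_1)
  qed
  finally have *: "(?Q + 2) * (?Q - 1) \<le> ?Q * ?Q - ?q" .
  have "1 < ?Q" using one_less_power[OF q, of "k + 1"] by simp
  have "False" if "1 < x" "1 < y" "(x + 2) * (x - 1) \<le> x * x - y" for x y :: nat
  proof -
    define z where "z = x - 2"
    have "x = z + 2" using that(1) by (simp add: z_def)
    then show False using that(2,3) by (simp add: algebra_simps)
  qed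
  then show False using * \<open>1 < ?Q\<close> q by blast
qed

subsection \<open>Codes in odd dimension\<close>

lemma sum_card_inter:
  assumes "finite Z" "finite B"
  shows "(\<Sum>x\<in>Z. real (card {U \<in> B. x \<in> U})) = (\<Sum>U\<in>B. real (card (U \<inter> Z)))"
proof -
  have "(\<Sum>x\<in>Z. card {U \<in> B. x \<in> U}) = (\<Sum>U\<in>B. card {x \<in> Z. x \<in> U})"
    using sum_multicount_gen[OF assms(2,1), of "\<lambda>U x. x \<in> U" "\<lambda>x. card {U \<in> B. x \<in> U}"] by simp
  moreover have "{x \<in> Z. x \<in> U} = U \<inter> Z" for U by auto
  ultimately show ?thesis by (simp flip: of_nat_sum)
qed

text \<open>Squaring the number of words through x counts ordered pairs of such words, the diagonal
  included. This is the second moment that Cauchy-Schwarz compares with the first one.\<close>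

lemma sum_card_inter_sq:
  assumes "finite Z" "finite B"
  shows "(\<Sum>x\<in>Z. (real (card {U \<in> B. x \<in> U}))\<^sup>2) = (\<Sum>U\<in>B. \<Sum>V\<in>B. real (card (U \<inter> V \<inter> Z)))"
proof -
  have "(\<Sum>x\<in>Z. (real (card {U \<in> B. x \<in> U}))\<^sup>2)
      = (\<Sum>x\<in>Z. real (card {P \<in> B \<times> B. x \<in> fst P \<inter> snd P}))"
  proof (rule sum.cong[OF refl])
    fix x
    have "{P \<in> B \<times> B. x \<in> fst P \<inter> snd P} = {U \<in> B. x \<in> U} \<times> {U \<in> B. x \<in> U}" by auto
    then show "(real (card {U \<in> B. x \<in> U}))\<^sup>2 = real (card {P \<in> B \<times> B. x \<in> fst P \<inter> snd P})"
      by (simp add: card_cartesian_product power2_eq_square)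
  qed
  also have "\<dots> = (\<Sum>P\<in>B \<times> B. real (card (fst P \<inter> snd P \<inter> Z)))"
  proof -
    have "(\<Sum>x\<in>Z. card {P \<in> B \<times> B. x \<in> fst P \<inter> snd P}) = (\<Sum>P\<in>B \<times> B. card {x \<in> Z. x \<in> fst P \<inter> snd P})"
      using sum_multicount_gen[of "B \<times> B" Z "\<lambda>P x. x \<in> fst P \<inter> snd P"
          "\<lambda>x. card {P \<in> B \<times> B. x \<in> fst P \<inter> snd P}"] assms by simp
    moreover have "{x \<in> Z. x \<in> fst P \<inter> snd P} = fst P \<inter> snd P \<inter> Z" for P by auto
    ultimately show ?thesis by (simp flip: of_nat_sum)
  qed
  also have "\<dots> = (\<Sum>U\<in>B. \<Sum>V\<in>B. real (card (U \<inter> V \<inter> Z)))"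
    by (simp add: sum.cartesian_product case_prod_unfold)
  finally show ?thesis .
qed

text \<open>
  Cauchy-Schwarz for the number of words of B through a nonzero vector outside all words of A.
\<close>

lemma mixed_code_ineq:
  fixes A B :: "('a::{field,finite} ^ 'n::finite) set set"
  assumes n: "CARD('n) = 2 * k + 1"
    and A: "\<And>U. U \<in> A \<Longrightarrow> vec.subspace U \<and> vec.dim U = k"
    and B: "\<And>U. U \<in> B \<Longrightarrow> vec.subspace U \<and> vec.dim U = k + 1"
    and AA: "\<And>U V. U \<in> A \<Longrightarrow> V \<in> A \<Longrightarrow> U \<noteq> V \<Longrightarrow> U \<inter> V = {0}"
    and AB: "\<And>U V. U \<in> A \<Longrightarrow> V \<in> B \<Longrightarrow> U \<inter> V = {0}"
    and BB: "\<And>U V. U \<in> B \<Longrightarrow> V \<in> B \<Longrightarrow> U \<noteq> V \<Longrightarrow> vec.dim (U \<inter> V) = 1"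
    and ne: "B \<noteq> {}"
  defines "q \<equiv> real CARD('a)" and "g \<equiv> real (CARD('a) ^ k)"
    and "a \<equiv> real (card A)" and "b \<equiv> real (card B)"
  shows "b * (q * g - 1)\<^sup>2 \<le> (q * g * g - 1 - a * (g - 1)) * (q * g - 1 + (b - 1) * (q - 1))"
proof -
  \<comment> \<open>With g = q^k, the quantities qg - 1 and qgg - 1 count the nonzero vectors of a
    word of \<open>B\<close> and of the whole space. Words of \<open>A\<close> and \<open>B\<close>
    meet in 0, so no nonzero vector of a word of \<open>B\<close> is lost in
    \<open>Z\<close>.\<close>
  define Z where "Z = UNIV - {0} - \<Union>A"
  have "1 < CARD('a)" by (rule CARD_field_gt_1)
  have pow: "1 \<le> CARD('a) ^ m" for m by simp
  have cardZ: "real (card Z) = q * g * g - 1 - a * (g - 1)"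
  proof -
    have "card (\<Union>U\<in>A. U - {0}) = (\<Sum>U\<in>A. card (U - {0}))"
      using AA by (intro card_UN_disjoint) auto
    also have "\<dots> = (\<Sum>U\<in>A. CARD('a) ^ k - 1)"
    proof (rule sum.cong[OF refl])
      fix U assume "U \<in> A"
      then show "card (U - {0}) = CARD('a) ^ k - 1" using card_subspace_nonzero[of U] A[of U] by simp
    qed
    finally have "real (card (\<Union>U\<in>A. U - {0})) = a * (g - 1)"
      using pow[of k] by (simp add: a_def g_def of_nat_diff)
    moreover have "Z = (UNIV - {0}) - (\<Union>U\<in>A. U - {0})" by (auto simp: Z_def)
    moreover have "card ((UNIV - {0}) - (\<Union>U\<in>A. U - {0})) =
        card (UNIV - {0 :: 'a ^ 'n}) - card (\<Union>U\<in>A. U - {0})"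
      by (rule card_Diff_subset) auto
    moreover have "card (\<Union>U\<in>A. U - {0}) \<le> card (UNIV - {0 :: 'a ^ 'n})"
      by (rule card_mono) auto
    moreover have "real (card (UNIV - {0 :: 'a ^ 'n})) = q * g * g - 1"
    proof -
      have "card (UNIV - {0 :: 'a ^ 'n}) = CARD('a) ^ (2 * k + 1) - 1"
        using card_subspace_nonzero[OF vec.subspace_UNIV, where 'a='a and 'n='n]
        unfolding dim_UNIV_vec n .
      then show ?thesis using pow[of "2 * k + 1"]
        by (simp add: of_nat_diff q_def g_def mult_2 power_add)
    qed
    ultimately show ?thesis by (simp only: of_nat_diff)
  qed
  have inZ: "U \<inter> Z = U - {0}" if "U \<in> B" for U
    using AB that unfolding Z_def by blast
  have s1: "(\<Sum>x\<in>Z. real (card {U \<in> B. x \<in> U})) = b * (q * g - 1)"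
  proof -
    have "real (card (U \<inter> Z)) = q * g - 1" if "U \<in> B" for U
      using card_subspace_nonzero[of U] B[OF that] inZ[OF that] pow[of "k + 1"]
      by (simp add: of_nat_diff q_def g_def)
    then have "(\<Sum>U\<in>B. real (card (U \<inter> Z))) = b * (q * g - 1)" by (simp add: b_def)
    then show ?thesis by (simp only: sum_card_inter[OF finite finite])
  qed
  \<comment> \<open>For a fixed word the diagonal contributes qg - 1, and each of the other b - 1
    words contributes the q - 1 nonzero vectors of a one-dimensional intersection.\<close>
  have s2: "(\<Sum>x\<in>Z. (real (card {U \<in> B. x \<in> U}))\<^sup>2) = b * (q * g - 1 + (b - 1) * (q - 1))"
  proof -
    have "(\<Sum>V\<in>B. real (card (U \<inter> V \<inter> Z))) = q * g - 1 + (b - 1) * (q - 1)" if "U \<in> B" for U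
    proof -
      have "real (card (U \<inter> U \<inter> Z)) = q * g - 1"
        using card_subspace_nonzero[of U] B[OF that] inZ[OF that] pow[of "k + 1"]
        by (simp add: of_nat_diff q_def g_def)
      moreover have "real (card (U \<inter> V \<inter> Z)) = q - 1" if V: "V \<in> B - {U}" for V
      proof -
        have "U \<inter> V \<inter> Z = U \<inter> V - {0}" using inZ[OF \<open>U \<in> B\<close>] by blast
        moreover have "vec.subspace (U \<inter> V)" "vec.dim (U \<inter> V) = 1"
          using B[OF \<open>U \<in> B\<close>] B[of V] V BB[OF \<open>U \<in> B\<close>] by (auto intro: vec.subspace_inter)
        ultimately show ?thesis using card_subspace_nonzero[of "U \<inter> V"] \<open>1 < CARD('a)\<close>
          by (simp add: of_nat_diff q_def)
      qed
      moreover have "real (card (B - {U})) = b - 1"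
        using card_Suc_Diff1[OF finite that] by (simp add: b_def flip: of_nat_Suc)
      moreover have "(\<Sum>V\<in>B. real (card (U \<inter> V \<inter> Z))) =
          real (card (U \<inter> U \<inter> Z)) + (\<Sum>V\<in>B - {U}. real (card (U \<inter> V \<inter> Z)))"
        using that by (intro sum.remove) auto
      ultimately show ?thesis by simp
    qed
    then have "(\<Sum>U\<in>B. \<Sum>V\<in>B. real (card (U \<inter> V \<inter> Z))) = b * (q * g - 1 + (b - 1) * (q - 1))"
      by (simp add: b_def)
    then show ?thesis by (simp only: sum_card_inter_sq[OF finite finite])
  qed
  have "0 < b" using ne by (simp add: b_def card_gt_0_iff)
  have "(b * (q * g - 1))\<^sup>2 \<le> b * (q * g - 1 + (b - 1) * (q - 1)) * (q * g * g - 1 - a * (g - 1))"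
    using sum_squared_le_sum_of_squares[of "\<lambda>x. real (card {U \<in> B. x \<in> U})" Z]
    unfolding s1 s2 cardZ .
  then have "b * (b * (q * g - 1)\<^sup>2) \<le> b * ((q * g * g - 1 - a * (g - 1)) * (q * g - 1 + (b - 1) * (q - 1)))"
    by (simp add: power_mult_distrib power2_eq_square algebra_simps)
  then show ?thesis using \<open>0 < b\<close> by (simp only: mult_le_cancel_left_pos)
qed

text \<open>
  At a = qg + 1 - b the right-hand side of the preceding inequality minus the left-hand side equals
  -(g - 1)(q - 1)(b - 1)(qg - b); this is negative strictly between the two extremal values of b.
\<close>

lemma mixed_numbers_contradiction:
  fixes a b q g :: real
  assumes "b * (q * g - 1)\<^sup>2 \<le> (q * g * g - 1 - a * (g - 1)) * (q * g - 1 + (b - 1) * (q - 1))"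
    and "1 < b" "b < q * g" "q * g + 1 \<le> a + b" "1 < q" "1 < g"
  shows False
proof -
  have "1 < q * g" using assms(5,6) by (rule less_1_mult)
  \<comment> \<open>The first factor decreases in a and the second is positive, so a may be replaced
    by its least value qg + 1 - b.\<close>
  have "q * g * g - 1 - a * (g - 1) \<le> q * g * g - 1 - (q * g + 1 - b) * (g - 1)"
    using assms(4,6) by (intro diff_left_mono mult_right_mono) auto
  then have "(q * g * g - 1 - a * (g - 1)) * (q * g - 1 + (b - 1) * (q - 1))
      \<le> (q * g * g - 1 - (q * g + 1 - b) * (g - 1)) * (q * g - 1 + (b - 1) * (q - 1))"
    using assms(2,5) \<open>1 < q * g\<close> by (intro mult_right_mono) auto
  also have "\<dots> = b * (q * g - 1)\<^sup>2 - (g - 1) * (q - 1) * (b - 1) * (q * g - b)"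
    by (simp add: power2_eq_square algebra_simps)
  also have "\<dots> < b * (q * g - 1)\<^sup>2"
    using assms(2,3,5,6) by simp
  finally show False using assms(1) by simp
qed

text \<open>For a = 1 the first factor is g (qg - 1), so one factor qg - 1 cancels and the
  inequality becomes linear in b. This settles b > qg, which
  \<open>mixed_numbers_contradiction\<close> leaves open.\<close>

lemma mixed_code_one_small:
  fixes b q g :: real
  assumes "b * (q * g - 1)\<^sup>2 \<le> (q * g * g - 1 - 1 * (g - 1)) * (q * g - 1 + (b - 1) * (q - 1))"
    "1 < q" "1 < g"
  shows "b \<le> q * g"
proof -
  have "1 < q * g" using assms(2,3) by (rule less_1_mult)
  have "(q * g - 1) * (b * (q * g - 1)) \<le> (q * g - 1) * (g * (q * g - 1 + (b - 1) * (q - 1)))"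
    using assms(1) by (simp add: power2_eq_square algebra_simps)
  then have "b * (q * g - 1) \<le> g * (q * g - 1 + (b - 1) * (q - 1))"
    using \<open>1 < q * g\<close> by (subst (asm) mult_le_cancel_left_pos) auto
  then have "b * (g - 1) \<le> (q * g) * (g - 1)" by (simp add: algebra_simps)
  then show ?thesis using assms(3) by simp
qed

text \<open>Again 2 dim X is a combination of three pair sums, which now lie between 2k and 2k + 2.
  If dim X = k + 2, any two other words have dimension at most k and sum at least 2k, so both have
  dimension k; the small case is dual. The form dim X + 1 = k avoids truncated subtraction.\<close>

lemma odd_code_dims:
  fixes C :: "('a::{field,finite} ^ 'n::finite) set set"
  assumes code: "is_code C (CARD('n) - 1)" and n: "CARD('n) = 2 * k + 1" and "3 \<le> card C"
    and X: "X \<in> C"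
  shows "vec.dim X \<in> {k - 1, k, k + 1, k + 2}"
    and "vec.dim X = k + 2 \<Longrightarrow> Y \<in> C \<Longrightarrow> Y \<noteq> X \<Longrightarrow> vec.dim Y = k"
    and "vec.dim X + 1 = k \<Longrightarrow> Y \<in> C \<Longrightarrow> Y \<noteq> X \<Longrightarrow> vec.dim Y = k + 1"
proof -
  have sums: "2 * k \<le> vec.dim X + vec.dim Y \<and> vec.dim X + vec.dim Y \<le> 2 * k + 2 \<and>
      2 * k \<le> vec.dim X + vec.dim Z \<and> vec.dim X + vec.dim Z \<le> 2 * k + 2 \<and>
      2 * k \<le> vec.dim Y + vec.dim Z \<and> vec.dim Y + vec.dim Z \<le> 2 * k + 2"
    if "Y \<in> C" "Z \<in> C" "X \<noteq> Y" "X \<noteq> Z" "Y \<noteq> Z" for Y Z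
    using code_pair(1,2)[OF code X that(1,3)] code_pair(1,2)[OF code X that(2,4)]
      code_pair(1,2)[OF code that(1,2,5)] n by simp
  obtain Y' where Y': "Y' \<in> C" "Y' \<noteq> X" using third_word[OF assms(3), of X X] .
  obtain Z where Z: "Z \<in> C" "Z \<noteq> X" "Z \<noteq> Y'" using third_word[OF assms(3), of X Y'] .
  show "vec.dim X \<in> {k - 1, k, k + 1, k + 2}"
    using sums[OF Y'(1) Z(1)] Y' Z by simp linarith
  show "vec.dim Y = k" if "vec.dim X = k + 2" "Y \<in> C" "Y \<noteq> X"
  proof -
    obtain Z where "Z \<in> C" "Z \<noteq> X" "Z \<noteq> Y" using third_word[OF assms(3), of X Y] .
    then show ?thesis using sums[of Y Z] that by force
  qed
  show "vec.dim Y = k + 1" if "vec.dim X + 1 = k" "Y \<in> C" "Y \<noteq> X"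
  proof -
    obtain Z where "Z \<in> C" "Z \<noteq> X" "Z \<noteq> Y" using third_word[OF assms(3), of X Y] .
    then show ?thesis using sums[of Y Z] that by force
  qed
qed

text \<open>All other words are k-spaces with pairwise trivial intersection, and each meets
  \<open>X\<close> in dimension 1. Outside \<open>X\<close> there are q^(k+1) (q^k - q) vectors, and
  each of these words takes q^k - q of them.\<close>

lemma odd_code_bound_large_word:
  fixes C :: "('a::{field,finite} ^ 'n::finite) set set"
  assumes code: "is_code C (CARD('n) - 1)" and n: "CARD('n) = 2 * k + 1" and k: "2 \<le> k"
    and C: "3 \<le> card C" and X: "X \<in> C" "vec.dim X = k + 2"
  shows "card C \<le> CARD('a) ^ (k + 1) + 1"
proof -
  let ?q = "CARD('a)"
  have q: "1 < ?q" by (rule CARD_field_gt_1)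
  have subX: "vec.subspace X" using code_subspace[OF code X(1)] .
  have dimY: "vec.dim Y = k" if "Y \<in> C - {X}" for Y
    using odd_code_dims(2)[OF code n C X] that by simp
  have "(\<Sum>U\<in>C - {X}. card (U - X)) \<le> card (UNIV - X)"
  proof (rule sum_card_Diff_le)
    show "U \<inter> V \<subseteq> X" if UV: "U \<in> C - {X}" "V \<in> C - {X}" "U \<noteq> V" for U V
    proof -
      have "U \<inter> V = {0}" using code_pair_disjoint[OF code, of U V] UV dimY n by simp
      then show ?thesis using vec.subspace_0[OF subX] by simp
    qed
  qed simp
  also have "card (UNIV - X) = ?q ^ (k + 1) * (?q ^ k - ?q)"
  proof -
    have "card (UNIV - X) = ?q ^ (2 * k + 1) - ?q ^ (k + 2)"
      using card_subspace_Diff[OF vec.subspace_UNIV subX]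
      by (simp only: dim_UNIV_vec n X Int_UNIV_left)
    moreover have "?q ^ (2 * k + 1) = ?q ^ (k + 1) * ?q ^ k" by (simp add: mult_2 power_add)
    ultimately show ?thesis by (simp add: diff_mult_distrib2 algebra_simps)
  qed
  also have "(\<Sum>U\<in>C - {X}. card (U - X)) = card (C - {X}) * (?q ^ k - ?q)"
  proof -
    have "card (U - X) = ?q ^ k - ?q" if U: "U \<in> C - {X}" for U
    proof -
      have "vec.dim (U \<inter> X) = 1" using code_pair(3)[OF code, of U X] U X dimY[OF U] n by simp
      then show ?thesis
        using card_subspace_Diff[OF code_subspace[OF code] subX, of U] U dimY[OF U] by simp
    qed
    then show ?thesis by simp
  qed
  finally have le: "card (C - {X}) * (?q ^ k - ?q) \<le> ?q ^ (k + 1) * (?q ^ k - ?q)" .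
  have "?q ^ 1 < ?q ^ k" using q k by (intro power_strict_increasing) auto
  then have "card (C - {X}) \<le> ?q ^ (k + 1)" using le by simp
  then show ?thesis using X(1) by (simp add: card_Diff_singleton)
qed

text \<open>Complementation makes \<open>X\<close> a word of dimension k + 2.\<close>

lemma odd_code_bound_small_word:
  fixes C :: "('a::{field,finite} ^ 'n::finite) set set"
  assumes code: "is_code C (CARD('n) - 1)" and n: "CARD('n) = 2 * k + 1" and k: "2 \<le> k"
    and C: "3 \<le> card C" and X: "X \<in> C" "vec.dim X + 1 = k"
  shows "card C \<le> CARD('a) ^ (k + 1) + 1"
proof -
  have sub: "C \<subseteq> subspaces" using code by (simp add: is_code_def)
  then have "vec.dim (perp X) = k + 2" using dim_perp[of X] X n by (auto simp: subspaces_def)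
  then show ?thesis
    using odd_code_bound_large_word[OF is_code_perp[OF code] n k, of "perp X"] C X
    by (simp add: card_perp_image[OF sub])
qed

text \<open>The partial spread bound gives a \<le> Q + 1 and, through complements, b \<le> Q + 1.
  The mixed inequality sharpens this to a \<le> Q if b \<ge> 1, to b \<le> Q if a = 1, and to a + b
  \<le> Q if both are at least 2.\<close>

lemma odd_code_bound_middle:
  fixes C :: "('a::{field,finite} ^ 'n::finite) set set"
  assumes code: "is_code C (CARD('n) - 1)" and n: "CARD('n) = 2 * k + 1" and k: "2 \<le> k"
    and dims: "\<And>X. X \<in> C \<Longrightarrow> vec.dim X \<in> {k, k + 1}"
  defines "A \<equiv> {U \<in> C. vec.dim U = k}" and "B \<equiv> {U \<in> C. vec.dim U = k + 1}"
  shows "card A + card B \<le> CARD('a) ^ (k + 1) + 1"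
    and "card A + card B = CARD('a) ^ (k + 1) + 1 \<Longrightarrow> card A \<le> 1 \<or> card B \<le> 1"
proof -
  define a b Q where "a = card A" and "b = card B" and "Q = CARD('a) ^ (k + 1)"
  have q: "1 < CARD('a)" by (rule CARD_field_gt_1)
  have sub: "vec.subspace U" if "U \<in> C" for U using code_subspace[OF code that] .
  have subC: "C \<subseteq> subspaces" using code by (simp add: is_code_def)
  have AC: "A \<subseteq> C" and BC: "B \<subseteq> C" by (auto simp: A_def B_def)
  have AA: "U \<inter> V = {0}" if "U \<in> A" "V \<in> A" "U \<noteq> V" for U V
    using code_pair_disjoint[OF code, of U V] that n by (simp add: A_def)
  have AB: "U \<inter> V = {0}" if "U \<in> A" "V \<in> B" for U V
  proof -
    have "U \<noteq> V" using that by (auto simp: A_def B_def)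
    then show ?thesis using code_pair_disjoint[OF code, of U V] that n by (simp add: A_def B_def)
  qed
  have BB: "vec.dim (U \<inter> V) = 1" if "U \<in> B" "V \<in> B" "U \<noteq> V" for U V
    using code_pair(3)[OF code, of U V] that n by (simp add: B_def)
  have a_bound: "a \<le> Q + 1"
    unfolding a_def Q_def by (rule partial_spread_bound[OF n k]) (use AA sub in \<open>auto simp: A_def\<close>)
  have b_bound: "b \<le> Q + 1"
  proof -
    have "card (perp ` B) \<le> Q + 1"
      unfolding Q_def
    proof (rule partial_spread_bound[OF n k])
      fix U assume "U \<in> perp ` B"
      then obtain X where X: "U = perp X" "X \<in> B" by blast
      then show "vec.subspace U" by (simp add: subspace_perp)
      show "vec.dim U = k" using X dim_perp[of X] sub n by (auto simp: B_def)
      fix V assume "V \<in> perp ` B" "U \<noteq> V"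
      then obtain Y where Y: "V = perp Y" "Y \<in> B" by blast
      then have "vec.dim V = k" using dim_perp[of Y] sub n by (auto simp: B_def)
      then show "U \<inter> V = {0}"
        using code_pair_disjoint[OF is_code_perp[OF code], of U V] X Y BC n \<open>U \<noteq> V\<close> \<open>vec.dim U = k\<close> by auto
    qed
    moreover have "card (perp ` B) = card B" using BC subC by (intro card_perp_image) blast
    ultimately show ?thesis by (simp add: b_def)
  qed
  define q g where "q = real CARD('a)" and "g = real (CARD('a) ^ k)"
  \<comment> \<open>Subfamilies of \<open>B\<close> inherit all hypotheses, so b may be lowered to
    any positive value.\<close>
  have ineq: "real b' * (q * g - 1)\<^sup>2 \<le> (q * g * g - 1 - real a * (g - 1)) * (q * g - 1 + (real b' - 1) * (q - 1))"
    if "1 \<le> b'" "b' \<le> b" for b'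
  proof -
    obtain B' where B': "B' \<subseteq> B" "card B' = b'" using \<open>b' \<le> b\<close> obtain_subset_with_card_n b_def by metis
    moreover from this have "B' \<noteq> {}" using \<open>1 \<le> b'\<close> by auto
    ultimately show ?thesis
      unfolding q_def g_def a_def B'(2)[symmetric]
      using mixed_code_ineq[OF n, of A B'] AA AB BB sub by (auto simp: A_def B_def subset_iff)
  qed
  have "1 < q" using q by (simp add: q_def)
  have "CARD('a) ^ 2 \<le> CARD('a) ^ k" using q k by (intro power_increasing) auto
  moreover have "2 * 2 \<le> CARD('a) ^ 2" using q by (simp only: power2_eq_square mult_le_mono)
  ultimately have g4: "4 \<le> CARD('a) ^ k" by simp
  then have "1 < CARD('a) ^ k" by linarith
  then have "1 < g" unfolding g_def by (metis of_nat_1 of_nat_less_iff)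
  have Q: "real Q = q * g" by (simp add: Q_def q_def g_def)
  have "Suc (Suc 0) < Q"
  proof -
    have "CARD('a) ^ k \<le> Q" unfolding Q_def using q by (intro power_increasing) auto
    then show ?thesis using g4 by simp
  qed
  \<comment> \<open>For b' = 1 the inequality only says that a single word of \<open>B\<close> fits
    into the space beside the words of \<open>A\<close>.\<close>
  have aQ: "a \<le> Q" if "1 \<le> b"
  proof -
    have "(q * g - 1) * (q * g - 1) \<le> (q * g - 1) * (q * g * g - 1 - real a * (g - 1))"
      using ineq[of 1] that by (simp add: power2_eq_square mult.commute)
    moreover have "1 < q * g" using \<open>1 < q\<close> \<open>1 < g\<close> by (rule less_1_mult)
    ultimately have "q * g - 1 \<le> q * g * g - 1 - real a * (g - 1)"
      by (subst (asm) mult_le_cancel_left_pos) auto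
    then have "real a * (g - 1) \<le> real Q * (g - 1)" by (simp add: Q algebra_simps)
    then show ?thesis using \<open>1 < g\<close> by simp
  qed
  have bQ: "b \<le> Q" if "a = 1"
  proof (cases "1 \<le> b")
    case True
    have "real b \<le> q * g"
      using ineq[OF True order_refl] \<open>1 < q\<close> \<open>1 < g\<close> unfolding that of_nat_1
      by (rule mixed_code_one_small)
    then show ?thesis by (simp flip: Q)
  qed simp
  have big: "a + b \<le> Q" if "2 \<le> a" "2 \<le> b"
  proof (rule ccontr)
    assume "\<not> a + b \<le> Q"
    \<comment> \<open>The contradiction needs 1 < b' < Q and a + b' \<ge> Q + 1, whereas b itself
      may exceed Q. This choice is the least that meets the lower bounds; it stays below Q because a
      \<ge> 2 and Q > 2.\<close>
    define b' where "b' = max 2 (Q + 1 - a)"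
    have b': "2 \<le> b'" "b' \<le> b" "b' < Q" "Q + 1 \<le> a + b'"
      using that \<open>\<not> a + b \<le> Q\<close> \<open>Suc (Suc 0) < Q\<close> by (auto simp: b'_def)
    show False
    proof (rule mixed_numbers_contradiction[OF ineq[of b']])
      show "1 \<le> b'" "1 < real b'" "b' \<le> b" using b' by simp_all
      show "real b' < q * g" using b'(3) by (simp flip: Q)
      have "real (Q + 1) \<le> real (a + b')" using b'(4) by (rule of_nat_mono)
      then show "q * g + 1 \<le> real a + real b'" by (simp add: Q)
    qed fact+
  qed
  have "a + b \<le> Q + 1 \<and> (a + b = Q + 1 \<longrightarrow> a \<le> 1 \<or> b \<le> 1)"
    using a_bound b_bound aQ bQ big by linarith
  then show "card A + card B \<le> CARD('a) ^ (k + 1) + 1"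
    "card A + card B = CARD('a) ^ (k + 1) + 1 \<Longrightarrow> card A \<le> 1 \<or> card B \<le> 1"
    by (auto simp: a_def b_def Q_def)
qed

subsection \<open>Extension fields\<close>

text \<open>For nonzero x, multiplication by x permutes the nonzero elements, so the factor x^(q-1)
  does not change their product.\<close>

lemma power_CARD_field:
  fixes x :: "'a::{field,finite}"
  shows "x ^ CARD('a) = x"
proof (cases "x = 0")
  case False
  have "(\<Prod>y\<in>UNIV-{0}. x * y) = (\<Prod>y\<in>UNIV-{0}. y)"
    by (rule prod.reindex_bij_witness[of _ "\<lambda>y. y / x" "\<lambda>y. x * y"]) (use False in auto)
  then have "x ^ card (UNIV - {0 :: 'a}) * (\<Prod>y\<in>UNIV-{0}. y) = 1 * (\<Prod>y\<in>UNIV-{0}. y)"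
    by (simp add: prod.distrib)
  then have "x ^ card (UNIV - {0 :: 'a}) = 1"
    by (subst (asm) mult_cancel_right) auto
  moreover have "CARD('a) = Suc (card (UNIV - {0 :: 'a}))"
    by (rule card_Suc_Diff1[symmetric]) auto
  ultimately show ?thesis by (metis power_Suc mult.right_neutral)
qed (use CARD_field_gt_1[where 'a='a] in simp)

text \<open>As polynomials in x both sides are monic of degree q, and they agree at the q elements
  of the base field.\<close>

lemma power_CARD_diff_eq_prod:
  fixes x :: "'a::{field,finite} alg_closure"
  shows "x ^ CARD('a) - x = (\<Prod>a\<in>UNIV. x - to_ac a)"
proof -
  let ?q = "CARD('a)"
  let ?p = "Polynomial.monom 1 ?q - Polynomial.monom 1 1 :: 'a alg_closure poly"
  let ?r = "\<Prod>a\<in>UNIV. [:- to_ac (a :: 'a), 1:]"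
  have q: "1 < ?q" by (rule CARD_field_gt_1)
  have deg_r: "Polynomial.degree ?r = ?q" by (subst degree_prod_sum_eq) auto
  have "Polynomial.coeff ?r (Polynomial.degree ?r) = 1" by (simp add: lead_coeff_prod)
  have "?p = ?r"
  proof (rule poly_eqI_degree_lead_coeff)
    show "Polynomial.coeff ?p ?q = Polynomial.coeff ?r ?q" using \<open>Polynomial.coeff ?r (Polynomial.degree ?r) = 1\<close> deg_r q by simp
    show "Polynomial.degree ?p \<le> ?q" using q by (intro degree_diff_le) (auto intro: order_trans[OF degree_monom_le])
    show "Polynomial.degree ?r \<le> ?q" by (simp add: deg_r)
    show "?q \<le> card (range (to_ac :: 'a \<Rightarrow> _))" by (simp add: card_image inj_to_ac)
    show "poly ?p z = poly ?r z" if "z \<in> range (to_ac :: 'a \<Rightarrow> _)" for z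
      using that by (auto simp: poly_monom poly_prod power_CARD_field simp flip: to_ac_power)
  qed
  then have "poly ?p x = poly ?r x" by simp
  then show ?thesis by (simp add: poly_monom poly_prod)
qed

text \<open>
  The order of a finite field is a power of its characteristic, but the next lemma avoids this
  fact: for a fixed x the polynomial (x + Y) ^ q - x ^ q - Y ^ q in Y has degree less than q and
  vanishes on the whole base field.
\<close>

lemma add_power_CARD:
  fixes x y :: "'a::{field,finite} alg_closure"
  shows "(x + y) ^ CARD('a) = x ^ CARD('a) + y ^ CARD('a)"
proof -
  let ?q = "CARD('a)"
  \<comment> \<open>Translation by a base field element permutes the factors of x^q - x.\<close>
  have base: "(x + to_ac a) ^ ?q = x ^ ?q + to_ac a" for a :: 'a
  proof -
    have "(\<Prod>b\<in>UNIV. (x + to_ac a) - to_ac b) = (\<Prod>b\<in>UNIV. x - to_ac (b :: 'a))"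
      by (rule prod.reindex_bij_witness[of _ "\<lambda>b. b + a" "\<lambda>b. b - a"]) auto
    then show ?thesis
      using power_CARD_diff_eq_prod[of x] power_CARD_diff_eq_prod[of "x + to_ac a"]
      by (simp add: algebra_simps)
  qed
  let ?p = "[:x, 1:] ^ ?q" and ?r = "[:x ^ ?q:] + Polynomial.monom 1 ?q :: 'a alg_closure poly"
  have q: "1 < ?q" by (rule CARD_field_gt_1)
  have "?p = ?r"
  proof (rule poly_eqI_degree_lead_coeff)
    have "Polynomial.coeff ?p (Polynomial.degree ?p) = 1" by (subst lead_coeff_power) simp
    moreover have "Polynomial.degree ?p = ?q" by (simp add: degree_power_eq)
    ultimately show "Polynomial.coeff ?p ?q = Polynomial.coeff ?r ?q" using q by (simp add: coeff_pCons split: nat.split)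
    show "Polynomial.degree ?p \<le> ?q" by (simp add: degree_power_eq)
    show "Polynomial.degree ?r \<le> ?q" by (intro degree_add_le) (auto intro: degree_monom_le)
    show "?q \<le> card (range (to_ac :: 'a \<Rightarrow> _))" by (simp add: card_image inj_to_ac)
    show "poly ?p z = poly ?r z" if "z \<in> range (to_ac :: 'a \<Rightarrow> _)" for z
      using that by (auto simp: poly_monom base power_CARD_field simp flip: to_ac_power)
  qed
  then have "poly ?p y = poly ?r y" by simp
  then show ?thesis by (simp add: poly_monom)
qed

lemma add_power_CARD_power:
  fixes x y :: "'a::{field,finite} alg_closure"
  shows "(x + y) ^ (CARD('a) ^ m) = x ^ (CARD('a) ^ m) + y ^ (CARD('a) ^ m)"
  by (induction m) (simp_all add: power_mult add_power_CARD mult.commute[of "CARD('a)"])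

text \<open>Adding 1 permutes the base field, so the sum of its elements stays the same although
  each of the q summands grows by 1. This makes the derivative of x^(q^m) - x constant.\<close>

lemma of_nat_CARD_alg_closure: "of_nat CARD('a::{field,finite}) = (0 :: 'a alg_closure)"
proof -
  have "(\<Sum>a\<in>UNIV. a + 1) = (\<Sum>a\<in>UNIV. a :: 'a)"
    by (rule sum.reindex_bij_witness[of _ "\<lambda>b. b - 1" "\<lambda>b. b + 1"]) auto
  then have "of_nat CARD('a) = (0 :: 'a)" by (simp add: sum.distrib)
  then show ?thesis using to_ac_of_nat[of "CARD('a)", where 'a='a] by simp
qed

text \<open>For m > 0 this is the subfield of order q^m, the fixed points of the m-fold Frobenius
  map. For m = 0 the equation reads x = x and the set is the whole closure.\<close>

definition ext_field :: "nat \<Rightarrow> 'a::{field,finite} alg_closure set" where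
  "ext_field m = {x. x ^ (CARD('a) ^ m) = x}"

text \<open>The polynomial x^(q^m) - x splits into linear factors. Its derivative is -1, which
  excludes double roots, so it has as many roots as its degree.\<close>

lemma card_ext_field:
  assumes "m > 0"
  shows "card (ext_field m :: 'a::{field,finite} alg_closure set) = CARD('a) ^ m"
proof -
  let ?Q = "CARD('a) ^ m"
  let ?p = "Polynomial.monom 1 ?Q - Polynomial.monom 1 1 :: 'a alg_closure poly"
  have Q: "1 < ?Q" using CARD_field_gt_1[where 'a='a] assms by (rule one_less_power)
  have deg: "Polynomial.degree ?p = ?Q"
    using Q degree_add_eq_left[of "- Polynomial.monom 1 1" "Polynomial.monom 1 ?Q :: 'a alg_closure poly"]
    by (simp add: degree_monom_eq)
  have "?p \<noteq> 0" using deg Q by auto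
  have lc: "Polynomial.coeff ?p ?Q = 1" using Q by simp
  from alg_closed_imp_factorization[OF \<open>?p \<noteq> 0\<close>]
  obtain A where A: "size A = ?Q" "?p = (\<Prod>x\<in>#A. [:-x, 1:])" unfolding deg lc by auto
  have "count A a \<le> 1" for a
  proof (rule ccontr)
    assume "\<not> count A a \<le> 1"
    then have "{#a, a#} \<subseteq># A" by (auto simp: subseteq_mset_def)
    then obtain B where "A = {#a, a#} + B" by (metis subset_mset.le_iff_add)
    then have "?p = [:-a, 1:] * ([:-a, 1:] * (\<Prod>x\<in>#B. [:-x, 1:]))" using A(2) by simp
    then have "poly (pderiv ?p) a = 0" by (simp only: pderiv_mult) simp
    moreover have "poly (pderiv ?p) a = - 1"
      using assms by (simp add: pderiv_diff pderiv_monom poly_monom of_nat_CARD_alg_closure)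
    ultimately show False by simp
  qed
  then have "A = mset_set (set_mset A)"
    by (intro multiset_eqI) (metis count_mset_set(1,3) finite_set_mset le_neq_implies_less less_one not_in_iff)
  then have "card (set_mset A) = ?Q" using A(1) by (metis size_mset_set)
  moreover have "set_mset A = ext_field m"
  proof -
    have "x \<in># A \<longleftrightarrow> x ^ ?Q - x = 0" for x
    proof -
      have "x ^ ?Q - x = poly ?p x" by (simp add: poly_monom)
      also have "\<dots> = (\<Prod>y\<in>#A. x - y)" unfolding A(2) by (simp add: poly_prod_mset image_mset.compositionality o_def)
      finally show ?thesis by (auto simp: prod_mset_zero_iff image_iff)
    qed
    then show ?thesis by (auto simp: ext_field_def)
  qed
  ultimately show ?thesis by simp
qed

lemma ext_field_mult: "x \<in> ext_field m \<Longrightarrow> y \<in> ext_field m \<Longrightarrow> x * y \<in> ext_field m"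
  by (simp add: ext_field_def power_mult_distrib)

lemma ext_field_add: "x \<in> ext_field m \<Longrightarrow> y \<in> ext_field m \<Longrightarrow> x + y \<in> ext_field m"
  by (simp add: ext_field_def add_power_CARD_power)

lemma to_ac_in_ext_field: "to_ac a \<in> ext_field m"
  unfolding ext_field_def mem_Collect_eq
  by (induction m) (simp_all add: power_mult power_CARD_field flip: to_ac_power)

lemma zero_in_ext_field: "0 \<in> ext_field m"
  using to_ac_in_ext_field[of 0 m] by simp

interpretation ac: vector_space "\<lambda>a (x :: 'a::field alg_closure). to_ac a * x"
  by unfold_locales (simp_all add: algebra_simps)

lemma subspace_ext_field: "ac.subspace (ext_field m :: 'a::{field,finite} alg_closure set)"
  by (rule ac.subspaceI) (auto intro: zero_in_ext_field ext_field_add ext_field_mult to_ac_in_ext_field)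

lemma ext_field_basis:
  assumes "m > 0"
  obtains B :: "'a::{field,finite} alg_closure set"
  where "finite B" "ac.independent B" "card B = m" "ac.span B = ext_field m"
proof -
  let ?K = "ext_field m :: 'a alg_closure set"
  obtain B where B: "B \<subseteq> ?K" "ac.independent B" "?K \<subseteq> ac.span B"
    using ac.maximal_independent_subset[of ?K] by auto
  have "CARD('a) ^ m > 0" by simp
  then have "finite ?K" using card_ext_field[OF assms] by (metis card.infinite less_irrefl)
  with B(1) have "finite B" using finite_subset by auto
  have "ac.span B = ?K" using B subspace_ext_field ac.span_minimal by blast
  moreover have "card B = m"
    using ac.card_span_independent[OF \<open>finite B\<close> B(2)] card_ext_field[OF assms, where 'a='a]
      CARD_field_gt_1[where 'a='a] by (simp add: calculation)
  ultimately show thesis using that B \<open>finite B\<close> by blast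
qed

subsection \<open>Extremal codes\<close>

text \<open>Independence for a basis indexed by a set of coordinates, so that the entries of a
  vector can serve as coefficients.\<close>

lemma ac_family_eq_0:
  assumes "bij_betw h N B" "finite N" "ac.independent B" "(\<Sum>i\<in>N. to_ac (u i) * h i) = 0" "i \<in> N"
  shows "u i = 0"
proof -
  have B: "finite B" "h ` N = B" using assms(1,2) by (auto simp: bij_betw_def)
  have inv: "inv_into N h (h j) = j" if "j \<in> N" for j
    using assms(1) that by (simp add: bij_betw_def)
  have "(\<Sum>b\<in>B. to_ac (u (inv_into N h b)) * b) = (\<Sum>i\<in>N. to_ac (u i) * h i)"
    by (subst sum.reindex_bij_betw[OF assms(1), symmetric]) (simp add: inv)
  then have "u (inv_into N h (h i)) = 0"
    using assms(3,4,5) B ac.independentD[of B B "\<lambda>b. u (inv_into N h b)" "h i"] by auto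
  then show ?thesis by (simp add: inv assms(5))
qed

lemma ac_family_span:
  assumes "bij_betw h N B" "finite N" "z \<in> ac.span B"
  obtains u where "z = (\<Sum>i\<in>N. to_ac (u i) * h i)"
proof -
  have B: "finite B" using assms(1,2) by (auto simp: bij_betw_def)
  obtain w where "z = (\<Sum>b\<in>B. to_ac (w b) * b)"
    using assms(3) ac.span_finite[OF B] by auto
  also have "\<dots> = (\<Sum>i\<in>N. to_ac (w (h i)) * h i)"
    by (subst sum.reindex_bij_betw[OF assms(1), symmetric]) simp
  finally show thesis using that[of "\<lambda>i. w (h i)"] by simp
qed

text \<open>
  Identify the coordinates with E \<oplus> K, where K is the field extension of degree m and E a
  k-dimensional subspace of K; the words are the graphs of the multiplications E \<rightarrow> K, x \<mapsto> c x,
  with c in K, and the special subspace is 0 \<oplus> K.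
\<close>

lemma exists_graph_partial_spread:
  assumes "0 < k" "k \<le> m" and n: "k + m = CARD('n::finite)"
  obtains S and P :: "('a::{field,finite} ^ 'n) set set"
  where "vec.subspace S" "vec.dim S = m" "card P = CARD('a) ^ m"
    "\<And>U. U \<in> P \<Longrightarrow> vec.subspace U \<and> vec.dim U = k \<and> U \<inter> S = {0}"
    "\<And>U V. U \<in> P \<Longrightarrow> V \<in> P \<Longrightarrow> U \<noteq> V \<Longrightarrow> U \<inter> V = {0}"
proof -
  have "0 < m" using assms by linarith
  let ?K = "ext_field m :: 'a alg_closure set"
  obtain B :: "'a alg_closure set" where B: "finite B" "ac.independent B" "card B = m" "ac.span B = ?K"
    using ext_field_basis[OF \<open>0 < m\<close>] by blast
  obtain B' where B': "B' \<subseteq> B" "card B' = k"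
    using obtain_subset_with_card_n[of k B] assms(2) B(3) by auto
  have ind': "ac.independent B'" using B(2) B'(1) by (rule ac.independent_mono)
  have "k \<le> card (UNIV :: 'n set)" using n by simp
  then obtain N :: "'n set" where N: "card N = k"
    using obtain_subset_with_card_n[of k UNIV] by auto
  then have "card (- N) = m" using n by (simp add: Compl_eq_Diff_UNIV card_Diff_subset)
  obtain h' where h': "bij_betw h' N B'"
    using finite_same_card_bij[of N B'] N B'(1,2) finite_subset[OF B'(1) B(1)] by auto
  obtain h where h: "bij_betw h (- N) B"
    using finite_same_card_bij[of "- N" B] \<open>card (- N) = m\<close> B(1,3) by auto
  \<comment> \<open>\<open>L\<close> reads the coordinates in \<open>N\<close> as an element of E,
    the span of \<open>B'\<close>, and \<open>R\<close> reads the others as an element of K.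
    Together they determine x.\<close>
  define L where "L x = (\<Sum>i\<in>N. to_ac (x $ i) * h' i)" for x :: "'a ^ 'n"
  define R where "R x = (\<Sum>i\<in>-N. to_ac (x $ i) * h i)" for x :: "'a ^ 'n"
  have L_add: "L (x + y) = L x + L y" and R_add: "R (x + y) = R x + R y" for x y
    by (simp_all add: L_def R_def algebra_simps sum.distrib)
  have L_scale: "L (c *s x) = to_ac c * L x" and R_scale: "R (c *s x) = to_ac c * R x" for c x
    by (simp_all add: L_def R_def algebra_simps sum_distrib_left)
  have L_0: "L 0 = 0" and R_0: "R 0 = 0" by (simp_all add: L_def R_def)
  have L_eq_0: "x $ i = 0" if "L x = 0" "i \<in> N" for x i
    using ac_family_eq_0[OF h' _ ind', of "\<lambda>i. x $ i" i] that by (simp add: L_def)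
  have R_eq_0: "x $ i = 0" if "R x = 0" "i \<notin> N" for x i
    using ac_family_eq_0[OF h _ B(2), of "\<lambda>i. x $ i" i] that by (simp add: R_def)
  have sum_in: "(\<Sum>i\<in>I. to_ac (u i) * g i) \<in> ?K" if "\<And>i. i \<in> I \<Longrightarrow> g i \<in> ?K" for I u and g :: "'n \<Rightarrow> _"
    by (rule ac.subspace_sum[OF subspace_ext_field]) (rule ext_field_mult[OF to_ac_in_ext_field that])
  have BK: "B \<subseteq> ?K" using B(4) ac.span_superset[of B] by simp
  have L_in: "L x \<in> ?K" and R_in: "R x \<in> ?K" for x
  proof -
    have "h' i \<in> ?K" if "i \<in> N" for i using bij_betwE[OF h'] B'(1) BK that by blast
    moreover have "h i \<in> ?K" if "i \<in> - N" for i using bij_betwE[OF h] BK that by blast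
    ultimately show "L x \<in> ?K" "R x \<in> ?K" unfolding L_def R_def by (blast intro: sum_in)+
  qed

  define S where "S = {x :: 'a ^ 'n. \<forall>i\<in>N. x $ i = 0}"
  define G where "G c = {x. R x = c * L x}" for c
  have S: "vec.subspace S" unfolding S_def vec.subspace_def by simp
  have "card S = CARD('a) ^ m" unfolding S_def card_coordinate_subspace using N n by (simp flip: n)
  then have dim_S: "vec.dim S = m" by (rule dim_eqI_card[OF S])
  have G: "vec.subspace (G c)" for c
    unfolding vec.subspace_def G_def by (simp add: L_0 R_0 L_add R_add L_scale R_scale algebra_simps)
  have L_S: "L x = 0" if "x \<in> S" for x using that by (simp add: L_def S_def)
  have eq_0: "x = 0" if "L x = 0" "R x = 0" for x
    using L_eq_0[OF that(1)] R_eq_0[OF that(2)] by (auto simp: vec_eq_iff)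
  have GS: "G c \<inter> S = {0}" for c
    using eq_0 L_S vec.subspace_0[OF S] vec.subspace_0[OF G] by (auto simp: G_def)
  have GG: "G c \<inter> G d = {0}" if "c \<noteq> d" for c d
  proof -
    have "x = 0" if "x \<in> G c" "x \<in> G d" for x
    proof -
      have "(c - d) * L x = 0" using that by (simp add: G_def algebra_simps)
      then have "L x = 0" using \<open>c \<noteq> d\<close> by simp
      moreover from this have "R x = 0" using that by (simp add: G_def)
      ultimately show ?thesis by (rule eq_0)
    qed
    then show ?thesis using vec.subspace_0[OF G] by blast
  qed
  \<comment> \<open>\<open>R\<close> maps \<open>S\<close> onto K, so for c in K any x can be
    corrected by some s in \<open>S\<close> to a point of the graph. Hence \<open>G c\<close> and
    \<open>S\<close> span the space, and the dimension formula applies.\<close>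
  have dim_G: "vec.dim (G c) = k" if "c \<in> ?K" for c
  proof -
    have "x \<in> vec.span (G c \<union> S)" for x
    proof -
      have "c * L x - R x \<in> ac.span B"
        unfolding B(4) by (intro ac.subspace_diff[OF subspace_ext_field] ext_field_mult that L_in R_in)
      then obtain u where u: "c * L x - R x = (\<Sum>i\<in>-N. to_ac (u i) * h i)"
        using ac_family_span[OF h finite] by blast
      define s where "s = (\<chi> i. if i \<in> N then 0 else u i)"
      have "s \<in> S" by (simp add: S_def s_def)
      have "R s = c * L x - R x" unfolding u by (auto simp: R_def s_def intro: sum.cong)
      then have "x + s \<in> G c" by (simp add: G_def L_add R_add L_S[OF \<open>s \<in> S\<close>])
      then have "(x + s) - s \<in> vec.span (G c \<union> S)"
        using \<open>s \<in> S\<close> by (intro vec.span_diff) (auto intro: vec.span_base)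
      then show ?thesis by simp
    qed
    then have "vec.span (G c \<union> S) = UNIV" by auto
    moreover have "vec.dim (UNIV :: ('a ^ 'n) set) = CARD('n)" by (simp add: vec_dim_card card_cart_basis)
    ultimately show ?thesis
      using dim_span_Un_Int[OF G[of c] S] GS[of c] n dim_S by simp
  qed
  have "inj_on G ?K"
  proof (rule inj_onI)
    fix c d assume cd: "c \<in> ?K" "d \<in> ?K" "G c = G d"
    show "c = d"
    proof (rule ccontr)
      assume "c \<noteq> d"
      then have "G c = {0}" using GG[of c d] cd(3) by simp
      then show False using dim_G[OF cd(1)] \<open>0 < k\<close> by simp
    qed
  qed
  then have card_P: "card (G ` ?K) = CARD('a) ^ m"
    by (simp add: card_image card_ext_field[OF \<open>0 < m\<close>])
  show thesis
  proof (rule that[OF S dim_S card_P])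
    show "vec.subspace U \<and> vec.dim U = k \<and> U \<inter> S = {0}" if "U \<in> G ` ?K" for U
      using that G dim_G GS by auto
    show "U \<inter> V = {0}" if UV: "U \<in> G ` ?K" "V \<in> G ` ?K" "U \<noteq> V" for U V
    proof -
      obtain c d where "U = G c" "V = G d" using UV(1,2) by blast
      then show ?thesis using GG[of c d] UV(3) by blast
    qed
  qed
qed

section \<open>Adding one word to a code\<close>

lemma sdist_commute: "sdist X Y = sdist Y X"
  by (simp add: sdist_def Un_commute Int_commute)

lemma is_code_insert:
  assumes "is_code P d" "vec.subspace X" "\<And>U. U \<in> P \<Longrightarrow> d \<le> sdist X U"
  shows "is_code (insert X P) d"
proof -
  have "d \<le> sdist U X" if "U \<in> P" for U using assms(3)[OF that] by (simp add: sdist_commute)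
  then show ?thesis using assms by (auto simp: is_code_def subspaces_def)
qed

lemma sdist_ge_disjoint:
  fixes X Y :: "('a::{field,finite} ^ 'n::finite) set"
  assumes "vec.subspace X" "vec.subspace Y" "X \<inter> Y = {0}"
    "CARD('n) \<le> vec.dim X + vec.dim Y + 1" "vec.dim X + vec.dim Y \<le> CARD('n)"
  shows "CARD('n) - 1 \<le> sdist X Y"
  using sdist_ge_iff[OF assms(1,2)] assms(3-5) by simp

text \<open>\<open>U\<close> and \<open>S\<close> already span the space, so enlarging
  \<open>S\<close> by one dimension only makes the intersection one-dimensional and lowers the
  distance from v to v - 1.\<close>

lemma sdist_ge_superspace:
  fixes S U W :: "('a::{field,finite} ^ 'n::finite) set"
  assumes "vec.subspace U" "vec.subspace S" "vec.subspace W" "U \<inter> S = {0}"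
    "vec.dim U + vec.dim S = CARD('n)" "S \<subseteq> W" "vec.dim W = vec.dim S + 1"
  shows "CARD('n) - 1 \<le> sdist W U"
proof -
  have "vec.dim (vec.span (U \<union> S)) = CARD('n)"
    using dim_span_Un_Int[OF assms(1,2)] assms(4,5) by simp
  moreover have "vec.dim (vec.span (U \<union> S)) \<le> vec.dim (vec.span (W \<union> U))"
    using assms(6) by (intro vec.dim_subset vec.span_mono) auto
  ultimately have "vec.dim (vec.span (W \<union> U)) = CARD('n)"
    using dim_le_CARD[of "vec.span (W \<union> U)"] by linarith
  then show ?thesis
    using dim_span_Un_Int[OF assms(3,1)] sdist_ge_iff[OF assms(3,1)] assms(5,7) by linarith
qed

text \<open>Adjoin a vector outside S + X. Taking \<open>X\<close> trivial simply raises the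
  dimension by one.\<close>

lemma obtain_superspace_avoiding:
  fixes S X :: "('a::{field,finite} ^ 'n::finite) set"
  assumes "vec.subspace S" "vec.subspace X" "S \<inter> X = {0}" "vec.dim S + vec.dim X < CARD('n)"
  obtains W where "vec.subspace W" "S \<subseteq> W" "vec.dim W = vec.dim S + 1" "W \<inter> X = {0}"
proof -
  have dim_SX: "vec.dim (vec.span (S \<union> X)) = vec.dim S + vec.dim X"
    using dim_span_Un_Int[OF assms(1,2)] assms(3) by simp
  then have "vec.span (S \<union> X) \<noteq> UNIV" using assms(4) dim_UNIV_vec by (metis less_irrefl)
  then obtain w where w: "w \<notin> vec.span (S \<union> X)" by blast
  then have "w \<notin> vec.span S" by (meson Un_upper1 subsetD vec.span_mono)
  let ?W = "vec.span (insert w S)"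
  have W: "vec.subspace ?W" by (rule vec.subspace_span)
  have dim_W: "vec.dim ?W = vec.dim S + 1"
    using \<open>w \<notin> vec.span S\<close> by (simp add: vec.dim_insert)
  have "vec.dim (vec.span (insert w (S \<union> X))) = vec.dim S + vec.dim X + 1"
    using w dim_SX by (simp add: vec.dim_insert)
  moreover have "vec.span (insert w (S \<union> X)) \<subseteq> vec.span (?W \<union> X)"
    by (intro vec.span_mono) (auto intro: vec.span_base)
  then have "vec.dim (vec.span (insert w (S \<union> X))) \<le> vec.dim (vec.span (?W \<union> X))"
    by (rule vec.dim_subset)
  ultimately have "vec.dim (?W \<inter> X) = 0"
    using dim_span_Un_Int[OF W assms(2)] dim_W by linarith
  then have "?W \<inter> X = {0}" using dim_eq_0_subspace[OF vec.subspace_inter[OF W assms(2)]] by blast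
  moreover have "S \<subseteq> ?W" by (auto intro: vec.span_base)
  ultimately show thesis using that[OF W _ dim_W] by blast
qed

lemma obtain_subspace_dim:
  fixes S :: "('a::{field,finite} ^ 'n::finite) set"
  assumes "vec.subspace S" "d \<le> vec.dim S"
  obtains T where "vec.subspace T" "T \<subseteq> S" "vec.dim T = d"
  using vec.choose_subspace_of_subspace[OF assms(2)] assms(1) by (metis vec.span_eq_iff)

section \<open>Computing dimension distributions and maxima\<close>

lemma dim_distr_Un_disjoint:
  fixes A B :: "('a::{field,finite} ^ 'n::finite) set set"
  assumes "A \<inter> B = {}"
  shows "dim_distr (A \<union> B) t = dim_distr A t + dim_distr B t"
proof -
  have "{U \<in> A \<union> B. vec.dim U = t} = {U \<in> A. vec.dim U = t} \<union> {U \<in> B. vec.dim U = t}" by auto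
  then show ?thesis using assms unfolding dim_distr_def by (simp add: card_Un_disjoint disjoint_iff)
qed

lemma dim_distr_const:
  assumes "\<And>U. U \<in> A \<Longrightarrow> vec.dim U = d"
  shows "dim_distr A t = (if t = d then card A else 0)"
proof -
  have "{U \<in> A. vec.dim U = t} = (if t = d then A else {})" using assms by auto
  then show ?thesis by (simp add: dim_distr_def)
qed

lemma dim_distr_insert:
  fixes P :: "('a::{field,finite} ^ 'n::finite) set set"
  assumes "X \<notin> P"
  shows "dim_distr (insert X P) t = (if t = vec.dim X then 1 else 0) + dim_distr P t"
  using dim_distr_Un_disjoint[of "{X}" P t] dim_distr_const[of "{X}" "vec.dim X" t] assms by simp

lemma distr_from_3:
  "distr_from s [a, b, c] = (\<lambda>t. if t = s then a else if t = s + 1 then b else if t = s + 2 then c else 0)"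
  (is "?l = ?r")
proof
  fix t
  show "?l t = ?r t"
  proof (cases "s \<le> t")
    case True
    then obtain d where "t = s + d" using le_Suc_ex by blast
    then show ?thesis by (simp add: distr_from_def nth_Cons')
  qed (simp add: distr_from_def)
qed

lemma distr_from_4:
  "distr_from s [a, b, c, d] = (\<lambda>t. if t = s then a else if t = s + 1 then b
    else if t = s + 2 then c else if t = s + 3 then d else 0)"
  (is "?l = ?r")
proof
  fix t
  show "?l t = ?r t"
  proof (cases "s \<le> t")
    case True
    then obtain e where "t = s + e" using le_Suc_ex by blast
    then show ?thesis by (simp add: distr_from_def nth_Cons')
  qed (simp add: distr_from_def)
qed

lemma Aq_eqI:
  fixes F :: "('a::{field,finite} ^ 'n::finite) itself" and C :: "('a ^ 'n) set set"
  assumes "is_code C d" "card C = N" "\<And>C :: ('a ^ 'n) set set. is_code C d \<Longrightarrow> card C \<le> N"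
  shows "Aq F d = N"
  unfolding Aq_def by (rule Max_eqI) (use assms in auto)

lemma Aq_const_eqI:
  fixes F :: "('a::{field,finite} ^ 'n::finite) itself" and C :: "('a ^ 'n) set set"
  assumes "is_code C d" "\<And>U. U \<in> C \<Longrightarrow> vec.dim U = k" "card C = N"
    "\<And>C :: ('a ^ 'n) set set. is_code C d \<Longrightarrow> (\<And>U. U \<in> C \<Longrightarrow> vec.dim U = k) \<Longrightarrow> card C \<le> N"
  shows "Aq_const F d k = N"
  unfolding Aq_const_def by (rule Max_eqI) (use assms in auto)

lemma is_code_mono: "is_code C d \<Longrightarrow> d' \<le> d \<Longrightarrow> is_code C d'"
  by (auto simp: is_code_def intro: order_trans)

lemma is_code_subset:
  assumes "is_code C d" "C' \<subseteq> C"
  shows "is_code C' d"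
  unfolding is_code_def
proof (intro conjI ballI impI)
  show "C' \<subseteq> subspaces" using assms by (meson is_code_def subset_trans)
  fix X Y assume "X \<in> C'" "Y \<in> C'" "X \<noteq> Y"
  then show "d \<le> sdist X Y" using assms subsetD[OF assms(2)] by (simp add: is_code_def)
qed

lemma subspace_Int_eq_0_mono:
  fixes S T U :: "('a::field ^ 'n::finite) set"
  assumes "vec.subspace T" "vec.subspace U" "T \<subseteq> S" "U \<inter> S = {0}"
  shows "T \<inter> U = {0}"
proof
  show "T \<inter> U \<subseteq> {0}" using assms(3,4) by blast
  show "{0} \<subseteq> T \<inter> U" using vec.subspace_0[OF assms(1)] vec.subspace_0[OF assms(2)] by simp
qed

lemma disjoint_family_is_code:
  fixes P :: "('a::{field,finite} ^ 'n::finite) set set"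
  assumes "\<And>U. U \<in> P \<Longrightarrow> vec.subspace U \<and> vec.dim U = k"
    "\<And>U V. U \<in> P \<Longrightarrow> V \<in> P \<Longrightarrow> U \<noteq> V \<Longrightarrow> U \<inter> V = {0}"
  shows "is_code P (2 * k)"
proof -
  have "sdist U V = 2 * k" if "U \<in> P" "V \<in> P" "U \<noteq> V" for U V
    using dim_span_Un_Int[of U V] assms(1)[OF that(1)] assms(1)[OF that(2)] assms(2)[OF that]
    by (simp add: sdist_def)
  then show ?thesis using assms(1) by (auto simp: is_code_def subspaces_def)
qed

section \<open>Codes with prescribed dimension distributions\<close>

lemma even_exists_spread:
  assumes n: "CARD('n::finite) = 2 * k" and k: "2 \<le> k"
  obtains S and P :: "('a::{field,finite} ^ 'n) set set"
  where "vec.subspace S" "vec.dim S = k" "card P = CARD('a) ^ k" "S \<notin> P"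
    "\<And>U. U \<in> P \<Longrightarrow> vec.subspace U \<and> vec.dim U = k \<and> U \<inter> S = {0}"
    "is_code (insert S P) (2 * k)"
proof -
  obtain S and P :: "('a ^ 'n) set set" where SP: "vec.subspace S" "vec.dim S = k" "card P = CARD('a) ^ k"
    "\<And>U. U \<in> P \<Longrightarrow> vec.subspace U \<and> vec.dim U = k \<and> U \<inter> S = {0}"
    "\<And>U V. U \<in> P \<Longrightarrow> V \<in> P \<Longrightarrow> U \<noteq> V \<Longrightarrow> U \<inter> V = {0}"
    by (rule exists_graph_partial_spread[of k k, where 'a='a and 'n='n]) (use n k in auto)
  have "S \<notin> P" using SP(2) SP(4)[of S] k by auto
  moreover have "is_code (insert S P) (2 * k)"
    by (rule disjoint_family_is_code) (use SP in \<open>auto simp: Int_commute\<close>)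
  ultimately show thesis using SP that by blast
qed

lemma even_realize:
  assumes n: "CARD('n::finite) = 2 * k" and k: "2 \<le> k"
    and D: "D \<in> {distr_from (k - 1) [0, CARD('a) ^ k + 1, 0], distr_from (k - 1) [1, CARD('a) ^ k, 0],
      distr_from (k - 1) [0, CARD('a) ^ k, 1], distr_from (k - 1) [1, CARD('a) ^ k - 1, 1]}"
  shows "\<exists>C :: ('a::{field,finite} ^ 'n) set set.
    is_code C (CARD('n) - 1) \<and> card C = CARD('a) ^ k + 1 \<and> dim_distr C = D"
proof -
  let ?Q = "CARD('a) ^ k"
  obtain S and P :: "('a ^ 'n) set set" where S: "vec.subspace S" "vec.dim S = k"
    and cardP: "card P = ?Q" and "S \<notin> P"
    and P: "\<And>U. U \<in> P \<Longrightarrow> vec.subspace U \<and> vec.dim U = k \<and> U \<inter> S = {0}"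
    and spread: "is_code (insert S P) (2 * k)"
    using even_exists_spread[OF n k, where 'a='a] by blast
  have code: "is_code (insert S P) (CARD('n) - 1)" by (rule is_code_mono[OF spread]) (use n in simp)
  then have codeP: "is_code P (CARD('n) - 1)" by (rule is_code_subset) auto
  have dP: "dim_distr P t = (if t = k then ?Q else 0)" for t
    using dim_distr_const[of P k t] P cardP by simp
  \<comment> \<open>This removes the truncated subtraction k - 1 when distributions are compared
    position by position.\<close>
  obtain s where s: "k = Suc s" using k by (cases k) auto
  consider "D = distr_from (k - 1) [0, ?Q + 1, 0]" | "D = distr_from (k - 1) [1, ?Q, 0]"
    | "D = distr_from (k - 1) [0, ?Q, 1]" | "D = distr_from (k - 1) [1, ?Q - 1, 1]" using D by blast
  then show ?thesis
  proof cases
    case 1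
    have "dim_distr (insert S P) = D"
      unfolding 1 distr_from_3 using s S by (auto simp: fun_eq_iff dim_distr_insert[OF \<open>S \<notin> P\<close>] dP)
    then show ?thesis using code cardP \<open>S \<notin> P\<close> by (intro exI[of _ "insert S P"]) simp
  next
    case 2
    obtain T where T: "vec.subspace T" "T \<subseteq> S" "vec.dim T = k - 1"
      using obtain_subspace_dim[OF S(1), of "k - 1"] S(2) by auto
    have "T \<notin> P" using P T(3) k by auto
    have "is_code (insert T P) (CARD('n) - 1)"
    proof (rule is_code_insert[OF codeP T(1)])
      fix U assume "U \<in> P"
      then have "T \<inter> U = {0}" using subspace_Int_eq_0_mono[OF T(1) _ T(2)] P by simp
      then show "CARD('n) - 1 \<le> sdist T U"
        using P[OF \<open>U \<in> P\<close>] T n k by (intro sdist_ge_disjoint) auto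
    qed
    moreover have "dim_distr (insert T P) = D"
      unfolding 2 distr_from_3 using s T by (auto simp: fun_eq_iff dim_distr_insert[OF \<open>T \<notin> P\<close>] dP)
    ultimately show ?thesis using cardP \<open>T \<notin> P\<close> by (intro exI[of _ "insert T P"]) simp
  next
    case 3
    obtain W where W: "vec.subspace W" "S \<subseteq> W" "vec.dim W = k + 1"
    proof (rule obtain_superspace_avoiding[OF S(1) vec.subspace_single_0])
      show "S \<inter> {0} = {0}" using vec.subspace_0[OF S(1)] by simp
      show "vec.dim S + vec.dim {0 :: 'a ^ 'n} < CARD('n)" using S(2) n k by simp
    qed (use S(2) in auto)
    have "W \<notin> P" using P W(3) by auto
    have "is_code (insert W P) (CARD('n) - 1)"
    proof (rule is_code_insert[OF codeP W(1)])
      fix U assume "U \<in> P"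
      then show "CARD('n) - 1 \<le> sdist W U"
        using P[OF \<open>U \<in> P\<close>] W S n by (intro sdist_ge_superspace[of U S W]) auto
    qed
    moreover have "dim_distr (insert W P) = D"
      unfolding 3 distr_from_3 using s W by (auto simp: fun_eq_iff dim_distr_insert[OF \<open>W \<notin> P\<close>] dP)
    ultimately show ?thesis using cardP \<open>W \<notin> P\<close> by (intro exI[of _ "insert W P"]) simp
  next
    case 4
    have "P \<noteq> {}" using cardP by auto
    then obtain U0 where U0: "U0 \<in> P" by blast
    define P' where "P' = P - {U0}"
    have P'P: "P' \<subseteq> P" by (auto simp: P'_def)
    have cardP': "card P' = ?Q - 1" using cardP U0 by (simp add: P'_def card_Diff_singleton)
    have dP': "dim_distr P' t = (if t = k then ?Q - 1 else 0)" for t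
      using dim_distr_const[of P' k t] P P'P cardP' by (simp add: subset_iff)
    \<comment> \<open>The fourth distribution shrinks one word \<open>U0\<close> to \<open>T\<close>
      and enlarges another one, \<open>S\<close>, to \<open>W\<close>. The dimensions of
      \<open>T\<close> and \<open>W\<close> add up to v, so \<open>W\<close> must avoid
      \<open>T\<close>; this is possible because \<open>S\<close> and \<open>T\<close> together
      leave one dimension free.\<close>
    obtain T where T: "vec.subspace T" "T \<subseteq> U0" "vec.dim T = k - 1"
      using obtain_subspace_dim[of U0 "k - 1"] P[OF U0] by auto
    have "S \<inter> T = {0}"
      using subspace_Int_eq_0_mono[OF T(1) S(1) T(2)] P[OF U0] by (simp add: Int_commute)
    moreover have "vec.dim S + vec.dim T < CARD('n)" using S(2) T(3) n k by simp
    ultimately obtain W where W: "vec.subspace W" "S \<subseteq> W" "vec.dim W = k + 1" "W \<inter> T = {0}"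
      using obtain_superspace_avoiding[OF S(1) T(1)] S(2) by metis
    have codeT: "is_code (insert T P') (CARD('n) - 1)"
    proof (rule is_code_insert[OF is_code_subset[OF codeP P'P] T(1)])
      fix U assume "U \<in> P'"
      then have U: "U \<in> P" "U \<noteq> U0" by (auto simp: P'_def)
      then have "U \<inter> U0 = {0}" using code_pair_disjoint[OF codeP U(1) U0 U(2)] P[OF U(1)] P[OF U0] n by simp
      then have "T \<inter> U = {0}" using subspace_Int_eq_0_mono[OF T(1) _ T(2)] P[OF U(1)] by simp
      then show "CARD('n) - 1 \<le> sdist T U"
        using P[OF U(1)] T n k by (intro sdist_ge_disjoint) auto
    qed
    have codeW: "is_code (insert W (insert T P')) (CARD('n) - 1)"
    proof (rule is_code_insert[OF codeT W(1)])
      fix U assume "U \<in> insert T P'"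
      then consider "U = T" | "U \<in> P" using P'P by blast
      then show "CARD('n) - 1 \<le> sdist W U"
      proof cases
        case 1
        then show ?thesis using W T n k by (intro sdist_ge_disjoint) auto
      next
        case 2
        then show ?thesis using P[OF 2] W S n by (intro sdist_ge_superspace[of U S W]) auto
      qed
    qed
    have notin: "T \<notin> P'" "W \<notin> insert T P'" using P P'P T(3) W(3) k by auto
    have "dim_distr (insert W (insert T P')) = D"
      unfolding 4 distr_from_3 using s W(3) T(3)
      by (auto simp: fun_eq_iff dim_distr_insert[OF notin(1)] dim_distr_insert[OF notin(2)] dP')
    moreover have "card (insert W (insert T P')) = ?Q + 1"
      using notin cardP' by (simp add: Suc_leI)
    ultimately show ?thesis using codeW by blast
  qed
qed

text \<open>The extra word \<open>X\<close> is a subspace of the (k+1)-space 0 \<oplus> K, that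
  space itself, or a superspace, according to d.\<close>

lemma odd_realize_low:
  assumes n: "CARD('n::finite) = 2 * k + 1" and k: "2 \<le> k"
    and d: "d \<in> {k, k + 1, k + 2}"
  shows "\<exists>(X :: ('a::{field,finite} ^ 'n) set) P. is_code (insert X P) (CARD('n) - 1) \<and> X \<notin> P \<and>
    card P = CARD('a) ^ (k + 1) \<and> (\<forall>U\<in>P. vec.dim U = k) \<and> vec.dim X = d"
proof -
  obtain S and P :: "('a ^ 'n) set set" where S: "vec.subspace S" "vec.dim S = k + 1"
    and cardP: "card P = CARD('a) ^ (k + 1)"
    and P: "\<And>U. U \<in> P \<Longrightarrow> vec.subspace U \<and> vec.dim U = k \<and> U \<inter> S = {0}"
    and PP: "\<And>U V. U \<in> P \<Longrightarrow> V \<in> P \<Longrightarrow> U \<noteq> V \<Longrightarrow> U \<inter> V = {0}"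
    by (rule exists_graph_partial_spread[of k "k + 1", where 'a='a and 'n='n]) (use n k in auto)
  have codeP: "is_code P (CARD('n) - 1)"
    using disjoint_family_is_code[of P k] P PP n by simp
  have "\<exists>X. vec.subspace X \<and> vec.dim X = d \<and> X \<notin> P \<and> (\<forall>U\<in>P. CARD('n) - 1 \<le> sdist X U)"
  proof (cases "d = k + 2")
    case True
    obtain W where W: "vec.subspace W" "S \<subseteq> W" "vec.dim W = k + 2"
    proof (rule obtain_superspace_avoiding[OF S(1) vec.subspace_single_0])
      show "S \<inter> {0} = {0}" using vec.subspace_0[OF S(1)] by simp
      show "vec.dim S + vec.dim {0 :: 'a ^ 'n} < CARD('n)" using S(2) n k by simp
    qed (use S(2) in auto)
    have "CARD('n) - 1 \<le> sdist W U" if "U \<in> P" for U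
      using P[OF that] W S n by (intro sdist_ge_superspace[of U S W]) auto
    moreover have "W \<notin> P" using P W(3) by auto
    ultimately show ?thesis using W True by (intro exI[of _ W]) simp
  next
    case False
    then have "d \<in> {k, k + 1}" using d by auto
    then have "d \<le> vec.dim S" using S(2) by auto
    then obtain T where T: "vec.subspace T" "T \<subseteq> S" "vec.dim T = d"
      by (rule obtain_subspace_dim[OF S(1)])
    have TU: "T \<inter> U = {0}" if "U \<in> P" for U
      using subspace_Int_eq_0_mono[OF T(1) _ T(2)] P[OF that] by simp
    have d_cases: "d = k \<or> d = k + 1" using \<open>d \<in> {k, k + 1}\<close> by simp
    have "T \<noteq> {0}" using T(3) d_cases k by auto
    then have "T \<notin> P" using TU[of T] by auto
    moreover have "CARD('n) - 1 \<le> sdist T U" if "U \<in> P" for U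
    proof (rule sdist_ge_disjoint[OF T(1) _ TU[OF that]])
      show "vec.subspace U" using P[OF that] by simp
      show "CARD('n) \<le> vec.dim T + vec.dim U + 1" "vec.dim T + vec.dim U \<le> CARD('n)"
        using conjunct1[OF conjunct2[OF P[OF that]]] T(3) n d_cases by linarith+
    qed
    ultimately show ?thesis using T by (intro exI[of _ T]) simp
  qed
  then obtain X where X: "vec.subspace X" "vec.dim X = d" "X \<notin> P" "\<And>U. U \<in> P \<Longrightarrow> CARD('n) - 1 \<le> sdist X U"
    by blast
  have "is_code (insert X P) (CARD('n) - 1)" by (rule is_code_insert[OF codeP X(1,4)])
  then show ?thesis using X(2,3) cardP P by (intro exI[of _ X] exI[of _ P]) simp
qed

text \<open>Three distributions consist of q^(k+1) words of dimension k and one more word; the other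
  three are their mirror images under t -> 2k + 1 - t, obtained by complementation.\<close>

lemma odd_realize:
  assumes n: "CARD('n::finite) = 2 * k + 1" and k: "2 \<le> k"
    and D: "D \<in> {distr_from (k - 1) [0, CARD('a) ^ (k + 1) + 1, 0, 0],
      distr_from (k - 1) [0, 0, CARD('a) ^ (k + 1) + 1, 0],
      distr_from (k - 1) [0, CARD('a) ^ (k + 1), 1, 0],
      distr_from (k - 1) [0, 1, CARD('a) ^ (k + 1), 0],
      distr_from (k - 1) [0, CARD('a) ^ (k + 1), 0, 1],
      distr_from (k - 1) [1, 0, CARD('a) ^ (k + 1), 0]}"
  shows "\<exists>C :: ('a::{field,finite} ^ 'n) set set.
    is_code C (CARD('n) - 1) \<and> card C = CARD('a) ^ (k + 1) + 1 \<and> dim_distr C = D"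
proof -
  let ?Q = "CARD('a) ^ (k + 1)"
  define f where "f d t = (if t = d then 1 else 0) + (if t = k then ?Q else 0)" for d t
  have low: "\<exists>C :: ('a ^ 'n) set set. is_code C (CARD('n) - 1) \<and> card C = ?Q + 1 \<and> dim_distr C = f d"
    if d: "d \<in> {k, k + 1, k + 2}" for d
  proof -
    obtain X :: "('a ^ 'n) set" and P where X: "is_code (insert X P) (CARD('n) - 1)" "X \<notin> P"
      "card P = ?Q" "\<forall>U\<in>P. vec.dim U = k" "vec.dim X = d"
      using odd_realize_low[OF n k d, where 'a='a] by blast
    have "dim_distr (insert X P) = f d"
      using dim_distr_const[of P k] X by (auto simp: fun_eq_iff dim_distr_insert f_def)
    then show ?thesis using X by (intro exI[of _ "insert X P"]) simp
  qed
  have high: "\<exists>C :: ('a ^ 'n) set set. is_code C (CARD('n) - 1) \<and> card C = ?Q + 1 \<and>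
      dim_distr C = (\<lambda>t. if t \<le> CARD('n) then f d (CARD('n) - t) else 0)"
    if d: "d \<in> {k, k + 1, k + 2}" for d
  proof -
    obtain C :: "('a ^ 'n) set set" where C: "is_code C (CARD('n) - 1)" "card C = ?Q + 1" "dim_distr C = f d"
      using low[OF d] by blast
    then have sub: "C \<subseteq> subspaces" by (simp add: is_code_def)
    have "dim_distr (perp ` C) t = 0" if "\<not> t \<le> CARD('n)" for t
    proof -
      have "{U \<in> perp ` C. vec.dim U = t} = {}" using dim_le_CARD that by blast
      then show ?thesis by (simp only: dim_distr_def card.empty)
    qed
    then have "dim_distr (perp ` C) = (\<lambda>t. if t \<le> CARD('n) then f d (CARD('n) - t) else 0)"
      using dim_distr_perp[OF sub] C(3) by (auto simp: fun_eq_iff)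
    then show ?thesis using is_code_perp[OF C(1)] C(2) card_perp_image[OF sub] by (intro exI[of _ "perp ` C"]) simp
  qed
  obtain s where s: "k = Suc s" using k by (cases k) auto
  have "distr_from (k - 1) [0, ?Q + 1, 0, 0] = f k" "distr_from (k - 1) [0, ?Q, 1, 0] = f (k + 1)"
    "distr_from (k - 1) [0, ?Q, 0, 1] = f (k + 2)"
    unfolding distr_from_4 using s by (auto simp: fun_eq_iff f_def)
  moreover have
    "distr_from (k - 1) [0, 0, ?Q + 1, 0] = (\<lambda>t. if t \<le> CARD('n) then f k (CARD('n) - t) else 0)"
    "distr_from (k - 1) [0, 1, ?Q, 0] = (\<lambda>t. if t \<le> CARD('n) then f (k + 1) (CARD('n) - t) else 0)"
    "distr_from (k - 1) [1, 0, ?Q, 0] = (\<lambda>t. if t \<le> CARD('n) then f (k + 2) (CARD('n) - t) else 0)"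
    unfolding distr_from_4 n using s by (auto simp: fun_eq_iff f_def)
  ultimately show ?thesis using D low high by auto
qed

subsection \<open>Classification\<close>

lemma even_code_classification:
  fixes C :: "('a::{field,finite} ^ 'n::finite) set set"
  assumes code: "is_code C (CARD('n) - 1)" and n: "CARD('n) = 2 * k" and k: "2 \<le> k"
  shows "card C \<le> CARD('a) ^ k + 1"
    and "card C = CARD('a) ^ k + 1 \<Longrightarrow> dim_distr C \<in> {distr_from (k - 1) [0, CARD('a) ^ k + 1, 0],
      distr_from (k - 1) [1, CARD('a) ^ k, 0],
      distr_from (k - 1) [0, CARD('a) ^ k, 1], distr_from (k - 1) [1, CARD('a) ^ k - 1, 1]}"
proof -
  let ?Q = "CARD('a) ^ k"
  have Q: "2 \<le> ?Q" using one_less_power[OF CARD_field_gt_1[where 'a='a], of k] k by simp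
  show "card C \<le> ?Q + 1"
  \<comment> \<open>With at most two words the dimensions are not confined to k - 1, k and k + 1,
    but the bound holds because q^k + 1 \<ge> 3.\<close>
  proof (cases "3 \<le> card C")
    case True
    then show ?thesis using even_code_bound[OF code n k] even_code_dims[OF code n] by blast
  qed (use Q in simp)
  show "dim_distr C \<in> {distr_from (k - 1) [0, ?Q + 1, 0], distr_from (k - 1) [1, ?Q, 0],
      distr_from (k - 1) [0, ?Q, 1], distr_from (k - 1) [1, ?Q - 1, 1]}" if card: "card C = ?Q + 1"
  proof -
    define A where "A = {U \<in> C. vec.dim U = k - 1}"
    define B where "B = {U \<in> C. vec.dim U = k}"
    define E where "E = {U \<in> C. vec.dim U = k + 1}"
    have dims: "vec.dim X \<in> {k - 1, k, k + 1}" if "X \<in> C" for X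
      using even_code_dims[OF code n _ that] card Q by simp
    then have C: "C = A \<union> B \<union> E" by (auto simp: A_def B_def E_def)
    have disj: "A \<inter> B = {}" "(A \<union> B) \<inter> E = {}" using k by (auto simp: A_def B_def E_def)
    have A1: "card A \<le> 1" unfolding A_def by (rule card_le_1_same_dim[OF code]) (use n k in arith)
    have E1: "card E \<le> 1" unfolding E_def by (rule card_le_1_same_dim[OF code]) (use n k in arith)
    have sum: "card A + card B + card E = ?Q + 1" using card disj unfolding C by (simp add: card_Un_disjoint)
    obtain s where s: "k = Suc s" using k by (cases k) auto
    have "dim_distr C t = (if t = k - 1 then card A else 0) + (if t = k then card B else 0)
        + (if t = k + 1 then card E else 0)" for t
      unfolding C using dim_distr_Un_disjoint[OF disj(2)] dim_distr_Un_disjoint[OF disj(1)]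
        dim_distr_const[of A "k - 1"] dim_distr_const[of B k] dim_distr_const[of E "k + 1"]
      by (simp add: A_def B_def E_def)
    then have "dim_distr C = distr_from (k - 1) [card A, card B, card E]"
      unfolding distr_from_3 using s by (auto simp: fun_eq_iff)
    moreover have "card A = 0 \<and> card B = ?Q + 1 \<and> card E = 0 \<or> card A = 1 \<and> card B = ?Q \<and> card E = 0
        \<or> card A = 0 \<and> card B = ?Q \<and> card E = 1 \<or> card A = 1 \<and> card B = ?Q - 1 \<and> card E = 1"
      using A1 E1 sum by linarith
    ultimately show ?thesis by auto
  qed
qed

lemma odd_code_classification:
  fixes C :: "('a::{field,finite} ^ 'n::finite) set set"
  assumes code: "is_code C (CARD('n) - 1)" and n: "CARD('n) = 2 * k + 1" and k: "2 \<le> k"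
  shows "card C \<le> CARD('a) ^ (k + 1) + 1"
    and "card C = CARD('a) ^ (k + 1) + 1 \<Longrightarrow> dim_distr C \<in>
      {distr_from (k - 1) [0, CARD('a) ^ (k + 1) + 1, 0, 0],
      distr_from (k - 1) [0, 0, CARD('a) ^ (k + 1) + 1, 0],
      distr_from (k - 1) [0, CARD('a) ^ (k + 1), 1, 0],
      distr_from (k - 1) [0, 1, CARD('a) ^ (k + 1), 0],
      distr_from (k - 1) [0, CARD('a) ^ (k + 1), 0, 1],
      distr_from (k - 1) [1, 0, CARD('a) ^ (k + 1), 0]}" (is "_ \<Longrightarrow> _ \<in> ?Ds")
proof -
  let ?Q = "CARD('a) ^ (k + 1)"
  obtain s where s: "k = Suc s" using k by (cases k) auto
  have Q: "2 \<le> ?Q" using one_less_power[OF CARD_field_gt_1[where 'a='a], of "k + 1"] by simp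
  have distr: "dim_distr C t = (if t = vec.dim X then 1 else 0) + (if t = d then card C - 1 else 0)"
    if "X \<in> C" "\<And>Y. Y \<in> C \<Longrightarrow> Y \<noteq> X \<Longrightarrow> vec.dim Y = d" for X d t
    using dim_distr_insert[of X "C - {X}" t] dim_distr_const[of "C - {X}" d t] that
    by (simp add: insert_absorb card_Diff_singleton)
  have "card C \<le> ?Q + 1 \<and> (card C = ?Q + 1 \<longrightarrow> dim_distr C \<in> ?Ds)" if C: "3 \<le> card C"
  proof -
    \<comment> \<open>A word of dimension k + 2 or k - 1 fixes the dimension of all others, so the
      distribution follows from the size alone; only the third case needs the mixed
      analysis.\<close>
    consider X where "X \<in> C" "vec.dim X = k + 2" | X where "X \<in> C" "vec.dim X + 1 = k"
      | "\<forall>X\<in>C. vec.dim X \<in> {k, k + 1}"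
      using odd_code_dims(1)[OF code n C] k by force
    then show ?thesis
    proof cases
      case 1
      have "dim_distr C t = (if t = k + 2 then 1 else 0) + (if t = k then card C - 1 else 0)" for t
        using distr[OF 1(1), of k t] odd_code_dims(2)[OF code n C 1] 1(2) by simp
      then have "card C = ?Q + 1 \<Longrightarrow> dim_distr C = distr_from (k - 1) [0, ?Q, 0, 1]"
        unfolding distr_from_4 using s by (auto simp: fun_eq_iff)
      then show ?thesis using odd_code_bound_large_word[OF code n k C 1] by auto
    next
      case 2
      have "dim_distr C t = (if t = vec.dim X then 1 else 0) + (if t = k + 1 then card C - 1 else 0)" for t
        using distr[OF 2(1), of "k + 1" t] odd_code_dims(3)[OF code n C 2] by simp
      then have "card C = ?Q + 1 \<Longrightarrow> dim_distr C = distr_from (k - 1) [1, 0, ?Q, 0]"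
        unfolding distr_from_4 using s 2(2) by (auto simp: fun_eq_iff)
      then show ?thesis using odd_code_bound_small_word[OF code n k C 2] by auto
    next
      case 3
      define A where "A = {U \<in> C. vec.dim U = k}"
      define B where "B = {U \<in> C. vec.dim U = k + 1}"
      have CAB: "C = A \<union> B" "A \<inter> B = {}" using 3 by (auto simp: A_def B_def)
      have sum: "card C = card A + card B" unfolding CAB(1) using CAB(2) by (simp add: card_Un_disjoint)
      have "dim_distr C t = (if t = k then card A else 0) + (if t = k + 1 then card B else 0)" for t
        unfolding CAB(1) using dim_distr_Un_disjoint[OF CAB(2)]
          dim_distr_const[of A k] dim_distr_const[of B "k + 1"]
        by (simp add: A_def B_def)
      then have distr_C: "dim_distr C = distr_from (k - 1) [0, card A, card B, 0]"
        unfolding distr_from_4 using s by (auto simp: fun_eq_iff)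
      have bound: "card A + card B \<le> ?Q + 1" "card A + card B = ?Q + 1 \<Longrightarrow> card A \<le> 1 \<or> card B \<le> 1"
        using odd_code_bound_middle[OF code n k] 3 unfolding A_def B_def by blast+
      have "dim_distr C \<in> ?Ds" if "card C = ?Q + 1"
      proof -
        have "card A = 0 \<and> card B = ?Q + 1 \<or> card A = 1 \<and> card B = ?Q
          \<or> card A = ?Q \<and> card B = 1 \<or> card A = ?Q + 1 \<and> card B = 0"
          using bound(2) sum that by linarith
        then show ?thesis unfolding distr_C by auto
      qed
      then show ?thesis using bound(1) sum by simp
    qed
  qed
  then show "card C \<le> ?Q + 1" "card C = ?Q + 1 \<Longrightarrow> dim_distr C \<in> ?Ds"
    using Q by (cases "3 \<le> card C"; simp)+
qed

theorem mainTheorem10: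
  fixes F :: "('a::{field,finite} ^ 'n::finite) itself"
  defines "q \<equiv> CARD('a)" and "v \<equiv> CARD('n)"
  shows
   "(\<forall>k. v = 2 * k \<and> v \<ge> 4 \<longrightarrow>
        Aq F (v - 1) = q ^ k + 1 \<and> Aq_const F v k = q ^ k + 1 \<and>
        (\<forall>C :: ('a ^ 'n) set set. is_code C (v - 1) \<and> card C = q ^ k + 1 \<longrightarrow>
            dim_distr C (k - 1) \<le> 1 \<and> dim_distr C (k + 1) \<le> 1 \<and>
            (\<forall>t. t \<notin> {k - 1, k, k + 1} \<longrightarrow> dim_distr C t = 0)) \<and>
        (\<forall>D. (\<exists>C :: ('a ^ 'n) set set. is_code C (v - 1) \<and> card C = q ^ k + 1 \<and> dim_distr C = D)
             \<longleftrightarrow> D \<in> {distr_from (k - 1) [0, q ^ k + 1, 0], distr_from (k - 1) [1, q ^ k, 0],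
                      distr_from (k - 1) [0, q ^ k, 1], distr_from (k - 1) [1, q ^ k - 1, 1]}))
    \<and>
    (\<forall>k. v = 2 * k + 1 \<and> v \<ge> 5 \<longrightarrow>
        Aq F (v - 1) = q ^ (k + 1) + 1 \<and> Aq_const F (v - 1) k = q ^ (k + 1) + 1 \<and>
        (\<forall>D. (\<exists>C :: ('a ^ 'n) set set. is_code C (v - 1) \<and> card C = q ^ (k + 1) + 1 \<and> dim_distr C = D)
             \<longleftrightarrow> D \<in> {distr_from (k - 1) [0, q ^ (k + 1) + 1, 0, 0],
                      distr_from (k - 1) [0, 0, q ^ (k + 1) + 1, 0],
                      distr_from (k - 1) [0, q ^ (k + 1), 1, 0],
                      distr_from (k - 1) [0, 1, q ^ (k + 1), 0],
                      distr_from (k - 1) [0, q ^ (k + 1), 0, 1],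
                      distr_from (k - 1) [1, 0, q ^ (k + 1), 0]}))"
proof (intro conjI allI impI)
  fix k assume "v = 2 * k \<and> v \<ge> 4"
  then have n: "CARD('n) = 2 * k" and k: "2 \<le> k" by (auto simp: v_def)
  obtain S and P :: "('a ^ 'n) set set" where S: "vec.subspace S" "vec.dim S = k"
    and cardP: "card P = CARD('a) ^ k" and "S \<notin> P"
    and P: "\<And>U. U \<in> P \<Longrightarrow> vec.subspace U \<and> vec.dim U = k \<and> U \<inter> S = {0}"
    and code: "is_code (insert S P) (2 * k)"
    using even_exists_spread[OF n k, where 'a='a] by blast
  have card: "card (insert S P) = q ^ k + 1" using cardP \<open>S \<notin> P\<close> by (simp add: q_def)
  have bound: "card C \<le> q ^ k + 1" if "is_code C (v - 1)" for C :: "('a ^ 'n) set set"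
    using even_code_classification(1)[OF _ n k, of C] that by (simp add: q_def v_def)
  \<comment> \<open>The spread has minimum distance v, so this one code attains both maxima.\<close>
  have code': "is_code (insert S P) v" using code n by (simp add: v_def)
  show "Aq F (v - 1) = q ^ k + 1"
    by (rule Aq_eqI[OF is_code_mono[OF code'] card bound]) auto
  show "Aq_const F v k = q ^ k + 1"
  proof (rule Aq_const_eqI[OF code' _ card])
    show "vec.dim U = k" if "U \<in> insert S P" for U using that S P by auto
    show "card C \<le> q ^ k + 1" if "is_code C v" for C :: "('a ^ 'n) set set"
      by (rule bound[OF is_code_mono[OF that]]) simp
  qed
  have cls: "dim_distr C \<in> {distr_from (k - 1) [0, q ^ k + 1, 0], distr_from (k - 1) [1, q ^ k, 0],
      distr_from (k - 1) [0, q ^ k, 1], distr_from (k - 1) [1, q ^ k - 1, 1]}"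
    if "is_code C (v - 1) \<and> card C = q ^ k + 1" for C :: "('a ^ 'n) set set"
    using even_code_classification(2)[OF _ n k, of C] that by (simp add: q_def v_def)
  obtain s where s: "k = Suc s" using k by (cases k) auto
  show "(\<exists>C :: ('a ^ 'n) set set. is_code C (v - 1) \<and> card C = q ^ k + 1 \<and> dim_distr C = D)
      \<longleftrightarrow> D \<in> {distr_from (k - 1) [0, q ^ k + 1, 0], distr_from (k - 1) [1, q ^ k, 0],
               distr_from (k - 1) [0, q ^ k, 1], distr_from (k - 1) [1, q ^ k - 1, 1]}" for D
    using cls even_realize[OF n k, of D, where 'a='a] unfolding q_def v_def by blast
  fix C :: "('a ^ 'n) set set" assume C: "is_code C (v - 1) \<and> card C = q ^ k + 1"
  show "dim_distr C (k - 1) \<le> 1" "dim_distr C (k + 1) \<le> 1"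
    using cls[OF C] s by (auto simp: distr_from_3)
  show "dim_distr C t = 0" if "t \<notin> {k - 1, k, k + 1}" for t
    using cls[OF C] s that by (auto simp: distr_from_3)
next
  fix k assume "v = 2 * k + 1 \<and> v \<ge> 5"
  then have n: "CARD('n) = 2 * k + 1" and k: "2 \<le> k" by (auto simp: v_def)
  have bound: "card C \<le> q ^ (k + 1) + 1" if "is_code C (v - 1)" for C :: "('a ^ 'n) set set"
    using odd_code_classification(1)[OF _ n k, of C] that by (simp add: q_def v_def)
  \<comment> \<open>Choosing the extra word of dimension k gives a constant-dimension code, which
    attains both maxima.\<close>
  obtain X :: "('a ^ 'n) set" and P where X: "is_code (insert X P) (v - 1)" "X \<notin> P"
    "card P = q ^ (k + 1)" "\<forall>U\<in>P. vec.dim U = k" "vec.dim X = k"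
    using odd_realize_low[OF n k, of k, where 'a='a] unfolding q_def v_def by blast
  then have card: "card (insert X P) = q ^ (k + 1) + 1" by simp
  show "Aq F (v - 1) = q ^ (k + 1) + 1" by (rule Aq_eqI[OF X(1) card bound])
  show "Aq_const F (v - 1) k = q ^ (k + 1) + 1"
    by (rule Aq_const_eqI[OF X(1) _ card bound]) (use X in auto)
  show "(\<exists>C :: ('a ^ 'n) set set. is_code C (v - 1) \<and> card C = q ^ (k + 1) + 1 \<and> dim_distr C = D)
      \<longleftrightarrow> D \<in> {distr_from (k - 1) [0, q ^ (k + 1) + 1, 0, 0],
               distr_from (k - 1) [0, 0, q ^ (k + 1) + 1, 0],
               distr_from (k - 1) [0, q ^ (k + 1), 1, 0],
               distr_from (k - 1) [0, 1, q ^ (k + 1), 0],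
               distr_from (k - 1) [0, q ^ (k + 1), 0, 1],
               distr_from (k - 1) [1, 0, q ^ (k + 1), 0]}" for D
    using odd_code_classification(2)[OF _ n k] odd_realize[OF n k, of D, where 'a='a]
    unfolding q_def v_def by blast
qed

end
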